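(* Consider a branching random walk whose progeny distribution $\{p_k:k\ge0\}$ satisfies $m:=\sum_{k\ge1}kp_k\in(1,\infty)$ and $\sum_{k\ge1}kp_k\log k<\infty$ (the super-critical Kesten–Stigum condition), and whose displacement variables have common distribution $\mathcal P$ on $\mathbb R$ with finite mean and a density $f$, satisfying the Langevin assumption of the context for a pair $(\rho,g)$ such that $g$ is strictly monotonic on $\mathbb R$. Moreover assume that $\Psi(t):=\log m+\log\mathbb E\exp(-tX)\in\mathbb R$ for some $t>0$, where $X\sim\mathcal P$. Then, conditionally on the underlying Galton–Watson tree $\mathbb T$ (for almost every realization of $\mathbb T$ that does not become extinct), the optimization problem sequence $\{\mathscr P_n:n\ge1\}$, where $\mathscr P_n$ is the problem of finding the left-most particle in the $n$-th generation, is stable under small perturbations with perturbation blocks $\mathcal J_n=\{J_{n,e}:e\in E_n\}$, where $J_{n,e}=\{e\}$ for all $e\in E_n$.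
   Context: Branching random walk. A particle at the origin splits into a random number of particles with law $\{p_k\}$, each new particle is displaced on $\mathbb R$ from its parent's position by a random amount with law $\mathcal P$, and this repeats independently for every particle in each generation. The genealogy is a rooted Galton–Watson tree $\mathbb T=(V,E)$; given $\mathbb T$, the displacements $\{X_e:e\in E\}$ are i.i.d. with law $\mathcal P$. $D_n$ is the set of vertices in generation $n$; $E_n$ is the set of edges with both end-vertices in generation $n$ or before; $I(v_1\leftrightarrow v_2)$ is the set of edges on the geodesic path between $v_1$ and $v_2$; $S_v=\sum_{e\in I(\mathrm{root}\leftrightarrow v)}X_e$. Conditionally on $\mathbb T$ (not extinct), problem $\mathscr P_n$ has inputs $\mathbf X^n=(X_e)_{e\in E_n}$ and is: minimize $S_v$ over $v\in D_n$. The parameter space $D_n$ has metric $d_n(v_1,v_2)=\frac1n\operatorname{card}(I(v_1\leftrightarrow v_2))$. The minimizer is almost surely unique, denoted $\widehat v_n(\mathbf X^n)$. All probabilities below are conditional on $\mathbb T$. Stability. $\mathcal J_n=\{J_{n,l}:l\in\mathcal L_n\}$ is a finite family of subsets of the input index set with union the whole index set; $m_n=\operatorname{card}(\mathcal L_n)$. For each $l$, $\mathbf X^{n,l}$ is an independent copy of $\mathbf X^n$ (no further assumption on the joint law over $l$), and $\mathbf X^n_l$ is $\mathbf X^n$ with the coordinates in $J_{n,l}$ replaced by those of $\mathbf X^{n,l}$. For a metric $\mathsf d$, $P(T,\mathsf d,\varepsilon)$ is the largest cardinality of a subset of $T$ with pairwise distances $>\varepsilon$. With $\mathcal O_{n,A}=\{\widehat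 v_n(\mathbf X^n_l):l\in A\}$, the sequence is stable under small perturbations with perturbation blocks $\mathcal J_n$ if for any $\varepsilon,\delta>0$ there is $M(\varepsilon,\delta)<\infty$ with $\limsup_{n\to\infty}\mathbb P[\min_{A\subseteq\mathcal L_n:|A|>(1-\varepsilon)m_n}P(\mathcal O_{n,A},d_n,\varepsilon)\ge M(\varepsilon,\delta)]\le\delta$. Sub-Gamma: an integrable real $X$ is in $\mathscr G(\sigma^2,c)$ if $\log\mathbb E\exp[\lambda(X-\mathbb EX)]\le\lambda^2\sigma^2/(2(1-c|\lambda|))$ for all $|\lambda|<1/c$ (all $\lambda$ if $c=0$). Langevin assumption (one-dimensional case) on $\mathcal P$ for the pair $(\rho,g)$, $\rho,g:\mathbb R\to\mathbb R$: (1) $\exp(-\rho)$ is integrable; (2) $\rho$ is Lebesgue-a.e. differentiable with Lipschitz derivative, or (2)$'$ $\rho$ is twice continuously differentiable and $(\rho')^2-\frac12\rho''$ is bounded below, or (2)$''$ $\rho$ is twice continuously differentiable and there are $a,b\in\mathbb R$ with $x\rho'(x)\ge-ax^2-b$ for all $x$ (any one suffices); (3) if $Y$ has density proportional to $\exp(-\rho)$, then $\rho'(Y)\in\mathscr G(\sigma^2,c)$ for some $\sigma^2>0$, $c\ge0$; (4) $g$ has uniformly bounded first and second derivatives and $g(Y)\sim\mathcal P$. *)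

theory Defs
  imports "HOL-Probability.Probability"
begin

section \<open>Galton--Watson trees\<close>

text \<open>
  Ulam--Harris labelling: the root is \<^term>\<open>[]\<close> and the children of \<^term>\<open>v\<close> are
  \<^term>\<open>v @ [i]\<close> for \<^term>\<open>i < N v\<close>, where \<^term>\<open>N v\<close> is the number of offspring of \<^term>\<open>v\<close>.
\<close>

type_synonym vertex = "nat list"
type_synonym edge = "vertex set"

definition gw_offspring :: "nat pmf \<Rightarrow> (vertex \<Rightarrow> nat) measure" where
  "gw_offspring p = PiM UNIV (\<lambda>_. measure_pmf p)"

definition gw_tree :: "(vertex \<Rightarrow> nat) \<Rightarrow> vertex set" where
  "gw_tree N = {v. \<forall>i<length v. v ! i < N (take i v)}"

definition mean_offspring :: "nat pmf \<Rightarrow> real" where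
  "mean_offspring p = (\<Sum>k. real k * pmf p k)"

text \<open>
  The condition \<open>m \<in> (1, \<infinity>)\<close> and \<open>\<Sum>k p\<^sub>k log k < \<infinity>\<close>.
  The term for \<open>k = 0\<close> vanishes.
\<close>

definition supercritical_kesten_stigum :: "nat pmf \<Rightarrow> bool" where
  "supercritical_kesten_stigum p \<longleftrightarrow>
     summable (\<lambda>k. real k * pmf p k) \<and> mean_offspring p > 1 \<and>
     summable (\<lambda>k. real k * pmf p k * ln (real k))"

definition generation :: "vertex set \<Rightarrow> nat \<Rightarrow> vertex set" where
  "generation T n = {v \<in> T. length v = n}"

definition extinct :: "vertex set \<Rightarrow> bool" where
  "extinct T \<longleftrightarrow> (\<exists>n. generation T n = {})"

definition edges :: "vertex set \<Rightarrow> edge set" where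
  "edges T = {{butlast v, v} | v. v \<in> T \<and> v \<noteq> []}"

definition edges_upto :: "vertex set \<Rightarrow> nat \<Rightarrow> edge set" where
  "edges_upto T n = {e \<in> edges T. \<forall>v\<in>e. length v \<le> n}"

definition walk :: "vertex set \<Rightarrow> vertex \<Rightarrow> vertex \<Rightarrow> vertex list \<Rightarrow> bool" where
  "walk T u v xs \<longleftrightarrow>
     xs \<noteq> [] \<and> hd xs = u \<and> last xs = v \<and> successively (\<lambda>a b. {a, b} \<in> edges T) xs"

definition geodesic :: "vertex set \<Rightarrow> vertex \<Rightarrow> vertex \<Rightarrow> vertex list \<Rightarrow> bool" where
  "geodesic T u v xs \<longleftrightarrow> walk T u v xs \<and> (\<forall>ys. walk T u v ys \<longrightarrow> length xs \<le> length ys)"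

definition walk_edges :: "vertex list \<Rightarrow> edge set" where
  "walk_edges xs = {{xs ! i, xs ! Suc i} | i. Suc i < length xs}"

text \<open>
  In a tree the geodesic between two vertices is unique, so that the union ranges over a
  single walk.
\<close>

definition geodesic_edges :: "vertex set \<Rightarrow> vertex \<Rightarrow> vertex \<Rightarrow> edge set" where
  "geodesic_edges T u v = (\<Union>xs\<in>{xs. geodesic T u v xs}. walk_edges xs)"

definition gen_dist :: "vertex set \<Rightarrow> nat \<Rightarrow> vertex \<Rightarrow> vertex \<Rightarrow> real" where
  "gen_dist T n u v = real (card (geodesic_edges T u v)) / real n"


section \<open>The left-most particle\<close>

definition position :: "vertex set \<Rightarrow> (edge \<Rightarrow> real) \<Rightarrow> vertex \<Rightarrow> real" where
  "position T x v = (\<Sum>e\<in>geodesic_edges T [] v. x e)"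

text \<open>
  The library's choice operator breaks ties by a function of the (finite) set of minimizers.
  Hence \<^term>\<open>\<lambda>x. leftmost T n x\<close> is measurable, and the choice only matters on a null set
  when the displacements are independent with a density.
\<close>

definition leftmost :: "vertex set \<Rightarrow> nat \<Rightarrow> (edge \<Rightarrow> real) \<Rightarrow> vertex" where
  "leftmost T n x = arg_min_on (position T x) (generation T n)"

text \<open>
  Conditionally on the tree, the displacements are an i.i.d. family indexed by its edges.
\<close>

definition iid_family :: "'w measure \<Rightarrow> 'i set \<Rightarrow> real measure \<Rightarrow> ('i \<Rightarrow> 'w \<Rightarrow> real) \<Rightarrow> bool" where
  "iid_family M I P X \<longleftrightarrow>
     prob_space.indep_vars M (\<lambda>_. borel) X I \<and> (\<forall>i\<in>I. distr M borel (X i) = P)"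

definition log_moment :: "real measure \<Rightarrow> real \<Rightarrow> ereal" where
  "log_moment P s =
     (if integrable P (\<lambda>x. exp (s * x)) then ereal (ln (\<integral>x. exp (s * x) \<partial>P)) else \<infinity>)"

definition Psi :: "nat pmf \<Rightarrow> real measure \<Rightarrow> real \<Rightarrow> ereal" where
  "Psi p P t = ereal (ln (mean_offspring p)) + log_moment P (- t)"


section \<open>Stability under small perturbations\<close>

definition independent_copy ::
  "'w measure \<Rightarrow> 'i set \<Rightarrow> ('i \<Rightarrow> 'w \<Rightarrow> real) \<Rightarrow> ('i \<Rightarrow> 'w \<Rightarrow> real) \<Rightarrow> bool" where
  "independent_copy M I X Y \<longleftrightarrow>
     prob_space.indep_var M
       (PiM I (\<lambda>_. borel)) (\<lambda>\<omega>. \<lambda>i\<in>I. X i \<omega>) (PiM I (\<lambda>_. borel)) (\<lambda>\<omega>. \<lambda>i\<in>I. Y i \<omega>) \<and>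
     distr M (PiM I (\<lambda>_. borel)) (\<lambda>\<omega>. \<lambda>i\<in>I. Y i \<omega>) =
     distr M (PiM I (\<lambda>_. borel)) (\<lambda>\<omega>. \<lambda>i\<in>I. X i \<omega>)"

definition perturbed :: "'i set \<Rightarrow> 'i set \<Rightarrow> ('i \<Rightarrow> real) \<Rightarrow> ('i \<Rightarrow> real) \<Rightarrow> 'i \<Rightarrow> real" where
  "perturbed I J x y = (\<lambda>i\<in>I. if i \<in> J then y i else x i)"

definition packing_number :: "('v \<Rightarrow> 'v \<Rightarrow> real) \<Rightarrow> real \<Rightarrow> 'v set \<Rightarrow> enat" where
  "packing_number d \<epsilon> T =
     (SUP S\<in>{S. S \<subseteq> T \<and> finite S \<and> (\<forall>u\<in>S. \<forall>v\<in>S. u \<noteq> v \<longrightarrow> d u v > \<epsilon>)}. enat (card S))"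

text \<open>
  The \<open>n\<close>-th problem has inputs \<^term>\<open>\<lambda>i. X n i \<omega>\<close> for \<^term>\<open>i \<in> I n\<close>, optimizer
  \<^term>\<open>vhat n\<close> and metric \<^term>\<open>d n\<close>; \<^term>\<open>Y n l\<close> is the independent copy of the input used
  on the block \<^term>\<open>J n l\<close>, for \<^term>\<open>l \<in> L n\<close>. The infimum is a minimum over a finite set.
\<close>

definition stable_under_small_perturbations ::
  "'w measure \<Rightarrow> (nat \<Rightarrow> 'i set) \<Rightarrow> (nat \<Rightarrow> 'i \<Rightarrow> 'w \<Rightarrow> real) \<Rightarrow>
   (nat \<Rightarrow> 'l set) \<Rightarrow> (nat \<Rightarrow> 'l \<Rightarrow> 'i set) \<Rightarrow> (nat \<Rightarrow> 'l \<Rightarrow> 'i \<Rightarrow> 'w \<Rightarrow> real) \<Rightarrow>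
   (nat \<Rightarrow> ('i \<Rightarrow> real) \<Rightarrow> 'v) \<Rightarrow> (nat \<Rightarrow> 'v \<Rightarrow> 'v \<Rightarrow> real) \<Rightarrow> bool" where
  "stable_under_small_perturbations M I X L J Y vhat d \<longleftrightarrow>
     (\<forall>n. finite (L n) \<and> (\<Union>l\<in>L n. J n l) = I n) \<and>
     (\<forall>\<epsilon>>0. \<forall>\<delta>>0. \<exists>K::nat.
        limsup (\<lambda>n. ereal (measure M {\<omega> \<in> space M.
          (INF A\<in>{A. A \<subseteq> L n \<and> real (card A) > (1 - \<epsilon>) * real (card (L n))}.
             packing_number (d n) \<epsilon>
               ((\<lambda>l. vhat n (perturbed (I n) (J n l) (\<lambda>i. X n i \<omega>) (\<lambda>i. Y n l i \<omega>))) ` A))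
          \<ge> enat K})) \<le> ereal \<delta>)"


section \<open>The Langevin assumption\<close>

definition sub_gamma :: "'w measure \<Rightarrow> ('w \<Rightarrow> real) \<Rightarrow> real \<Rightarrow> real \<Rightarrow> bool" where
  "sub_gamma M X v c \<longleftrightarrow>
     integrable M X \<and>
     (\<forall>s. c * \<bar>s\<bar> < 1 \<longrightarrow>
        integrable M (\<lambda>\<omega>. exp (s * (X \<omega> - (\<integral>\<omega>. X \<omega> \<partial>M)))) \<and>
        ln (\<integral>\<omega>. exp (s * (X \<omega> - (\<integral>\<omega>. X \<omega> \<partial>M))) \<partial>M) \<le> s\<^sup>2 * v / (2 * (1 - c * \<bar>s\<bar>)))"

definition gibbs :: "(real \<Rightarrow> real) \<Rightarrow> real measure" where
  "gibbs \<rho> = density lborel (\<lambda>x. ennreal (exp (- \<rho> x) / (\<integral>y. exp (- \<rho> y) \<partial>lborel)))"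

definition twice_cont_diff :: "(real \<Rightarrow> real) \<Rightarrow> (real \<Rightarrow> real) \<Rightarrow> (real \<Rightarrow> real) \<Rightarrow> bool" where
  "twice_cont_diff f f' f'' \<longleftrightarrow>
     (\<forall>x. (f has_real_derivative f' x) (at x)) \<and>
     (\<forall>x. (f' has_real_derivative f'' x) (at x)) \<and> continuous_on UNIV f''"

definition langevin_regular :: "(real \<Rightarrow> real) \<Rightarrow> (real \<Rightarrow> real) \<Rightarrow> bool" where
  "langevin_regular \<rho> \<rho>' \<longleftrightarrow>
     ((AE x in lborel. (\<rho> has_real_derivative \<rho>' x) (at x)) \<and> (\<exists>C. C-lipschitz_on UNIV \<rho>')) \<or>
     (\<exists>\<rho>''. twice_cont_diff \<rho> \<rho>' \<rho>'' \<and> (\<exists>b. \<forall>x. (\<rho>' x)\<^sup>2 - \<rho>'' x / 2 \<ge> b)) \<or>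
     (\<exists>\<rho>''. twice_cont_diff \<rho> \<rho>' \<rho>'' \<and> (\<exists>a b. \<forall>x. x * \<rho>' x \<ge> - a * x\<^sup>2 - b))"

text \<open>
  The derivative \<^term>\<open>\<rho>'\<close> is quantified rather than written \<^term>\<open>deriv \<rho>\<close>: the function
  \<^term>\<open>deriv \<rho>\<close> has unspecified values, hence may fail to be Borel, where \<^term>\<open>\<rho>\<close> is not
  differentiable. Two admissible choices of \<^term>\<open>\<rho>'\<close> agree almost everywhere.
\<close>

definition langevin :: "real measure \<Rightarrow> (real \<Rightarrow> real) \<Rightarrow> (real \<Rightarrow> real) \<Rightarrow> bool" where
  "langevin P \<rho> g \<longleftrightarrow>
     integrable lborel (\<lambda>x. exp (- \<rho> x)) \<and>
     (\<exists>\<rho>'. langevin_regular \<rho> \<rho>' \<and> (\<exists>v>0. \<exists>c\<ge>0. sub_gamma (gibbs \<rho>) \<rho>' v c)) \<and>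
     (\<exists>g' g'' C. (\<forall>x. (g has_real_derivative g' x) (at x) \<and>
        (g' has_real_derivative g'' x) (at x) \<and> \<bar>g' x\<bar> \<le> C \<and> \<bar>g'' x\<bar> \<le> C)) \<and>
     distr (gibbs \<rho>) borel g = P"

end

theory Submission
  imports Defs
begin

text \<open>
  Resampling the weight of one edge \<open>e\<close> changes the left-most particle only if \<open>e\<close> lies on the
  path to the left-most particle before or after the resampling. Since the resampled input has the
  law of the original one, both events have the same probability, and these probabilities sum over
  all edges to the length \<open>n\<close> of the path to the (almost surely unique) left-most particle. Hence
  the expected number of edges whose resampling moves the left-most particle is at most \<open>2 n\<close>,
  whereas on survival the number of edges grows faster than linearly. By Markov's inequality all but
  a small fraction of the perturbed problems have one and the same optimizer, with high probability.
\<close>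

section \<open>Paths in Galton--Watson trees\<close>

text \<open>Superlinear growth of the edge set is derived from the generation sizes: almost surely
  every positive size is left for good, so on survival the sizes tend to infinity, and the number of
  edges is their sum. Ties and measurability shape the rest. The optimizer is a choice among
  possibly tied minimizers, and the perturbed inputs have no prescribed joint law over the edges.
  The comparison of optimizers is therefore deterministic and concerns the whole set of minimizers,
  an edge being critical if it lies on the path to any of them. Uniqueness enters only when critical
  edges are counted in expectation, where a null set is harmless, and expectations add up whatever
  the joint law. Markov's bound is attached to a measurable event that contains the event in
  question, so that no measurability of the infimum over subfamilies has to be shown. The outcome is
  the bound 2n / (\<epsilon> |E_n|): the 2 stands for before and after, and \<epsilon> |E_n| is the
  number of perturbations that may be discarded.\<close>

lemma Nil_in_gw_tree [simp]: "[] \<in> gw_tree N"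
  by (simp add: gw_tree_def)

lemma snoc_in_gw_tree: "v @ [i] \<in> gw_tree N \<longleftrightarrow> v \<in> gw_tree N \<and> i < N v"
  by (auto simp: gw_tree_def nth_append less_Suc_eq)

lemma take_in_gw_tree: "v \<in> gw_tree N \<Longrightarrow> take k v \<in> gw_tree N"
  by (auto simp: gw_tree_def)

lemma generation_0: "generation (gw_tree N) 0 = {[]}"
  by (auto simp: generation_def)

lemma generation_Suc:
  "generation (gw_tree N) (Suc n) =
     (\<lambda>(v, i). v @ [i]) ` (SIGMA v:generation (gw_tree N) n. {..<N v})"
proof -
  have "\<exists>u i. v = u @ [i] \<and> u \<in> generation (gw_tree N) n \<and> i < N u"
    if "v \<in> generation (gw_tree N) (Suc n)" for v
    using that by (cases v rule: rev_cases) (auto simp: generation_def snoc_in_gw_tree)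
  then show ?thesis
    by (force simp: generation_def snoc_in_gw_tree)
qed

lemma finite_generation: "finite (generation (gw_tree N) n)"
  by (induction n) (auto simp: generation_0 generation_Suc)

lemma card_generation_Suc:
  "card (generation (gw_tree N) (Suc n)) = (\<Sum>v\<in>generation (gw_tree N) n. N v)"
proof -
  have "inj_on (\<lambda>(v, i). v @ [i]) (SIGMA v:generation (gw_tree N) n. {..<N v})"
    by (auto simp: inj_on_def)
  then show ?thesis
    by (simp add: generation_Suc card_image finite_generation)
qed

text \<open>Edges are indexed by their endpoint farther from the root.\<close>

definition parent_edge :: "vertex \<Rightarrow> edge" where
  "parent_edge v = {butlast v, v}"

text \<open>Explicit form of the geodesic edge set from the root. The shift \<open>Suc i\<close>
  leaves out the empty prefix, which is the far endpoint of no edge.\<close>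

definition path_edges :: "vertex \<Rightarrow> edge set" where
  "path_edges v = (\<lambda>i. parent_edge (take (Suc i) v)) ` {..<length v}"

text \<open>A crosswise match of the two doubletons would make each of \<open>u\<close> and
  \<open>v\<close> strictly shorter than the other.\<close>

lemma inj_on_parent_edge: "inj_on parent_edge {v. v \<noteq> []}"
proof (rule inj_onI)
  fix u v :: vertex
  assume "u \<in> {v. v \<noteq> []}" "v \<in> {v. v \<noteq> []}" and eq: "parent_edge u = parent_edge v"
  then have "length (butlast u) < length u" "length (butlast v) < length v"
    by auto
  with eq show "u = v"
    unfolding parent_edge_def doubleton_eq_iff by (metis less_asym)
qed

lemma parent_edge_in_path_edges: "v \<noteq> [] \<Longrightarrow> parent_edge v \<in> path_edges v"
  unfolding path_edges_def by (rule image_eqI[where x = "length v - 1"]) auto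

text \<open>By injectivity \<open>u\<close> would be a prefix of \<open>v\<close>, hence equal to it
  because the lengths agree. This gives each path to generation \<open>n\<close> a weight that a
  competing path does not use, which is what rules out ties.\<close>

lemma parent_edge_notin_path_edges:
  assumes "length u = length v" "u \<noteq> v"
  shows "parent_edge u \<notin> path_edges v"
proof
  assume "parent_edge u \<in> path_edges v"
  then obtain i where i: "i < length v" "parent_edge u = parent_edge (take (Suc i) v)"
    by (auto simp: path_edges_def)
  moreover have "u \<noteq> []" "take (Suc i) v \<noteq> []"
    using assms i by auto
  ultimately have "u = take (Suc i) v"
    using inj_on_parent_edge by (auto simp: inj_on_def)
  with assms show False
    by auto
qed

lemma card_path_edges_le: "card (path_edges v) \<le> length v"
  unfolding path_edges_def using card_image_le[of "{..<length v}"] by auto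

text \<open>Each edge changes the depth by exactly one, so a walk to \<open>v\<close> takes at least
  \<open>length v\<close> steps, and a walk with no more than these can only descend through the
  prefixes of \<open>v\<close>. The induction removes the last step.\<close>

lemma walk_from_root_length:
  assumes "walk T [] v xs"
  shows "length v < length xs \<and>
    (length xs = Suc (length v) \<longrightarrow> xs = map (\<lambda>i. take i v) [0..<Suc (length v)])"
  using assms
proof (induction xs arbitrary: v rule: rev_induct)
  case Nil
  then show ?case
    by (simp add: walk_def)
next
  case (snoc b ys)
  have b: "b = v"
    using snoc.prems by (simp add: walk_def)
  show ?case
  proof (cases "ys = []")
    case True
    with snoc.prems show ?thesis
      by (auto simp: walk_def)
  next
    case False
    define a where "a = last ys"
    have ys: "walk T [] a ys" and edge: "{a, v} \<in> edges T"
      using snoc.prems False b by (auto simp: walk_def a_def successively_append_iff)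
    note IH = snoc.IH[OF ys]
    from edge obtain w where w: "w \<noteq> []" "{a, v} = {butlast w, w}"
      by (auto simp: edges_def)
    then consider "v \<noteq> []" "a = butlast v" | "a \<noteq> []" "v = butlast a"
      by (auto simp: doubleton_eq_iff)
    then show ?thesis
    proof cases
      case 1
      then have len: "length v = Suc (length a)"
        by simp
      have "ys @ [b] = map (\<lambda>i. take i v) [0..<Suc (length v)]"
        if "length (ys @ [b]) = Suc (length v)"
      proof -
        from that len IH have "ys = map (\<lambda>i. take i a) [0..<Suc (length a)]"
          by simp
        also have "\<dots> = map (\<lambda>i. take i v) [0..<Suc (length a)]"
        proof (rule map_cong)
          fix i
          assume "i \<in> set [0..<Suc (length a)]"
          then have "i < length v"
            using len by auto
          then show "take i a = take i v"
            using 1 by (simp add: take_butlast)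
        qed simp
        finally show ?thesis
          using b len by simp
      qed
      then show ?thesis
        using IH len by auto
    next
      \<comment> \<open>The last step goes up from a child \<open>a\<close> of \<open>v\<close>. The
        walk to \<open>a\<close> is already too long for equality, so the second claim is
        vacuous.\<close>
      case 2
      then show ?thesis
        using IH by auto
    qed
  qed
qed

lemma walk_prefixes:
  assumes "v \<in> gw_tree N"
  shows "walk (gw_tree N) [] v (map (\<lambda>i. take i v) [0..<Suc (length v)])"
proof -
  have "{take i v, take (Suc i) v} \<in> edges (gw_tree N)" if "i < length v" for i
  proof -
    have "{take i v, take (Suc i) v} = {butlast (take (Suc i) v), take (Suc i) v}"
      using that by (simp add: butlast_take)
    moreover have "take (Suc i) v \<in> gw_tree N" "take (Suc i) v \<noteq> []"
      using that take_in_gw_tree[OF assms] by auto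
    ultimately show ?thesis
      unfolding edges_def by blast
  qed
  then have "successively (\<lambda>a b. {a, b} \<in> edges (gw_tree N))
      (map (\<lambda>i. take i v) [0..<Suc (length v)])"
    unfolding successively_conv_nth by (auto simp del: upt_Suc)
  then show ?thesis
    by (simp add: walk_def hd_map del: upt_Suc) (simp add: hd_append)
qed

lemma geodesic_edges_from_root:
  assumes "v \<in> gw_tree N"
  shows "geodesic_edges (gw_tree N) [] v = path_edges v"
proof -
  let ?xs = "map (\<lambda>i. take i v) [0..<Suc (length v)]"
  note pre = walk_prefixes[OF assms]
  have "geodesic (gw_tree N) [] v xs \<longleftrightarrow> xs = ?xs" for xs
  proof
    assume xs: "geodesic (gw_tree N) [] v xs"
    then have walk: "walk (gw_tree N) [] v xs" and "length xs \<le> length ?xs"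
      using pre unfolding geodesic_def by blast+
    then show "xs = ?xs"
      using walk_from_root_length[OF walk] by simp
  next
    assume xs: "xs = ?xs"
    have "length ?xs \<le> length ys" if "walk (gw_tree N) [] v ys" for ys
      using walk_from_root_length[OF that] by simp
    then show "geodesic (gw_tree N) [] v xs"
      unfolding geodesic_def xs using pre by blast
  qed
  then have "geodesic_edges (gw_tree N) [] v = walk_edges ?xs"
    by (simp add: geodesic_edges_def)
  also have "\<dots> = path_edges v"
  proof -
    define xs where "xs = ?xs"
    have len: "length xs = Suc (length v)"
      and nth: "\<And>i. i \<le> length v \<Longrightarrow> xs ! i = take i v"
      by (simp_all add: xs_def del: upt_Suc)
    have "walk_edges xs = (\<lambda>i. {xs ! i, xs ! Suc i}) ` {..<length v}"
      by (auto simp: walk_edges_def len)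
    also have "\<dots> = path_edges v"
      unfolding path_edges_def parent_edge_def
      by (intro image_cong) (simp_all add: nth butlast_take)
    finally show ?thesis
      by (simp only: xs_def)
  qed
  finally show ?thesis .
qed

section \<open>Counting edges by generations\<close>

lemma edges_upto_gw_tree:
  "edges_upto (gw_tree N) n = parent_edge ` {v \<in> gw_tree N. v \<noteq> [] \<and> length v \<le> n}"
  by (fastforce simp: edges_upto_def edges_def parent_edge_def)

lemma path_edges_subset:
  assumes "v \<in> generation (gw_tree N) n"
  shows "path_edges v \<subseteq> edges_upto (gw_tree N) n"
proof
  fix e
  assume "e \<in> path_edges v"
  then obtain i where i: "i < length v" "e = parent_edge (take (Suc i) v)"
    by (auto simp: path_edges_def)
  moreover have "take (Suc i) v \<in> gw_tree N" "take (Suc i) v \<noteq> []"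
    "length (take (Suc i) v) \<le> n"
    using assms i(1) by (auto simp: generation_def take_in_gw_tree)
  ultimately show "e \<in> edges_upto (gw_tree N) n"
    unfolding edges_upto_gw_tree by blast
qed

lemma edges_upto_Un:
  "{v \<in> gw_tree N. v \<noteq> [] \<and> length v \<le> n} = (\<Union>k\<in>{0<..n}. generation (gw_tree N) k)"
  by (auto simp: generation_def)

lemma finite_edges_upto: "finite (edges_upto (gw_tree N) n)"
  by (simp add: edges_upto_gw_tree edges_upto_Un finite_generation)

lemma card_edges_upto:
  "card (edges_upto (gw_tree N) n) = (\<Sum>k\<in>{0<..n}. card (generation (gw_tree N) k))"
proof -
  have "card (edges_upto (gw_tree N) n) = card {v \<in> gw_tree N. v \<noteq> [] \<and> length v \<le> n}"
    unfolding edges_upto_gw_tree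
    by (intro card_image inj_on_subset[OF inj_on_parent_edge]) auto
  also have "\<dots> = (\<Sum>k\<in>{0<..n}. card (generation (gw_tree N) k))"
    unfolding edges_upto_Un
    by (intro card_UN_disjoint) (auto simp: finite_generation, auto simp: generation_def)
  finally show ?thesis .
qed

lemma edges_upto_superlinear:
  assumes "filterlim (\<lambda>n. card (generation (gw_tree N) n)) at_top sequentially"
  shows "(\<lambda>n. real n / real (card (edges_upto (gw_tree N) n))) \<longlonglongrightarrow> 0"
proof (rule LIMSEQ_I)
  fix r :: real
  assume "r > 0"
  \<comment> \<open>The first \<open>n0\<close> generations are discarded, which for
    \<open>n > 2 * n0\<close> costs at most half of the \<open>n\<close> levels; the factor 2
    compensates for this.\<close>
  obtain C :: nat where C: "2 / r < real C"
    using reals_Archimedean2 by blast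
  obtain n0 where n0: "\<And>k. k \<ge> n0 \<Longrightarrow> C \<le> card (generation (gw_tree N) k)"
    using assms by (auto simp: filterlim_at_top eventually_sequentially)
  have "norm (real n / real (card (edges_upto (gw_tree N) n)) - 0) < r"
    if n: "n \<ge> Suc (2 * n0)" for n
  proof -
    have "(n - n0) * C = (\<Sum>k\<in>{n0<..n}. C)"
      by simp
    also have "\<dots> \<le> (\<Sum>k\<in>{n0<..n}. card (generation (gw_tree N) k))"
      using n0 by (intro sum_mono) auto
    also have "\<dots> \<le> card (edges_upto (gw_tree N) n)"
      unfolding card_edges_upto by (intro sum_mono2) auto
    finally have "real (n - n0) * real C \<le> real (card (edges_upto (gw_tree N) n))"
      by (metis of_nat_le_iff of_nat_mult)
    moreover have "real n / 2 * real C \<le> real (n - n0) * real C"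
      using n by (intro mult_right_mono) auto
    moreover have "real n < r * (real n / 2 * real C)"
      using C n \<open>r > 0\<close> by (simp add: field_simps)
    ultimately have "real n < r * real (card (edges_upto (gw_tree N) n))"
      using \<open>r > 0\<close> by (smt (verit) mult_left_mono)
    moreover from this have "real (card (edges_upto (gw_tree N) n)) > 0"
      using \<open>r > 0\<close> by (smt (verit) mult_nonneg_nonpos of_nat_0_le_iff)
    ultimately show ?thesis
      by (simp add: field_simps)
  qed
  then show "\<exists>no. \<forall>n\<ge>no. norm (real n / real (card (edges_upto (gw_tree N) n)) - 0) < r"
    by blast
qed

section \<open>Growth of Galton--Watson trees\<close>

lemma space_gw_offspring [simp]: "space (gw_offspring p) = UNIV"
  by (simp add: gw_offspring_def space_PiM)

lemma prob_space_gw_offspring: "prob_space (gw_offspring p)"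
  unfolding gw_offspring_def by (intro prob_space_PiM prob_space_measure_pmf)

lemma measurable_offspring: "(\<lambda>N. N v) \<in> measurable (gw_offspring p) (count_space UNIV)"
proof -
  have "(\<lambda>N. N v) \<in> measurable (gw_offspring p) (measure_pmf p)"
    unfolding gw_offspring_def by (rule measurable_component_singleton) simp
  then show ?thesis
    by (simp add: measurable_def)
qed

lemma sets_offspring: "{N. N v \<in> S} \<in> sets (gw_offspring p)"
  using measurable_sets[OF measurable_offspring[of v p], of S] by (simp add: vimage_def)

lemma sets_in_gw_tree: "{N. v \<in> gw_tree N} \<in> sets (gw_offspring p)"
proof -
  have "{N \<in> space (gw_offspring p). \<forall>i\<in>{..<length v}. v ! i < N (take i v)}
      \<in> sets (gw_offspring p)"
    using sets_offspring[of "take _ v" "{_<..}"] by (intro sets.sets_Collect_finite_All) auto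
  also have "{N \<in> space (gw_offspring p). \<forall>i\<in>{..<length v}. v ! i < N (take i v)} =
      {N. v \<in> gw_tree N}"
    by (auto simp: gw_tree_def)
  finally show ?thesis .
qed

lemma sets_generation_eq: "{N. generation (gw_tree N) n = D} \<in> sets (gw_offspring p)"
proof -
  have "{N \<in> space (gw_offspring p). v \<notin> gw_tree N} \<in> sets (gw_offspring p)" for v
    using sets_in_gw_tree by (intro sets.sets_Collect_neg) simp
  then have "{N \<in> space (gw_offspring p). (length v = n \<and> v \<in> gw_tree N) \<longleftrightarrow> v \<in> D}
      \<in> sets (gw_offspring p)" for v
    using sets_in_gw_tree[of v p] sets.top[of "gw_offspring p"] by (cases "length v = n"; cases "v \<in> D") auto
  then have "{N \<in> space (gw_offspring p). \<forall>v. (length v = n \<and> v \<in> gw_tree N) \<longleftrightarrow> v \<in> D}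
      \<in> sets (gw_offspring p)"
    by (intro sets.sets_Collect_countable_All)
  also have "{N \<in> space (gw_offspring p). \<forall>v. (length v = n \<and> v \<in> gw_tree N) \<longleftrightarrow> v \<in> D} =
      {N. generation (gw_tree N) n = D}"
    by (auto simp: generation_def)
  finally show ?thesis .
qed

lemma sets_finite_offspring:
  "finite D \<Longrightarrow> {N. \<forall>v\<in>D. N v \<in> S} \<in> sets (gw_offspring p)"
  using sets.sets_Collect_finite_All[of D "gw_offspring p" "\<lambda>v N. N v \<in> S"] sets_offspring by auto

lemma prob_finite_offspring:
  assumes "finite D"
  shows "measure (gw_offspring p) {N. \<forall>v\<in>D. N v \<in> S} = measure (measure_pmf p) S ^ card D"
proof -
  interpret product_prob_space "\<lambda>_. measure_pmf p" "UNIV :: vertex set" ..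
  have "emeasure (PiM UNIV (\<lambda>_. measure_pmf p))
      {N \<in> space (PiM UNIV (\<lambda>_. measure_pmf p)). \<forall>v\<in>D. N v \<in> S} =
      (\<Prod>v\<in>D. emeasure (measure_pmf p) S)"
    using assms by (intro emeasure_PiM_Collect) auto
  then have "emeasure (gw_offspring p) {N. \<forall>v\<in>D. N v \<in> S} =
      ennreal (measure (measure_pmf p) S ^ card D)"
    by (simp add: gw_offspring_def space_PiM measure_pmf.emeasure_eq_measure ennreal_power)
  then show ?thesis
    by (rule measure_eq_emeasure_eq_ennreal[rotated]) simp
qed

lemma indep_offspring: "prob_space.indep_vars (gw_offspring p) (\<lambda>_. measure_pmf p) (\<lambda>v N. N v) UNIV"
proof -
  interpret prob_space "gw_offspring p"
    by (rule prob_space_gw_offspring)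
  have [simp]: "distr (gw_offspring p) (measure_pmf p) (\<lambda>N. N v) = measure_pmf p" for v
    unfolding gw_offspring_def by (rule distr_PiM_component) (auto intro: prob_space_measure_pmf)
  have "(\<lambda>N. N v) \<in> measurable (gw_offspring p) (measure_pmf p)" for v
    unfolding gw_offspring_def by (rule measurable_component_singleton) simp
  moreover have "distr (gw_offspring p) (PiM UNIV (\<lambda>_. measure_pmf p)) (\<lambda>N. \<lambda>v\<in>UNIV. N v) =
      PiM UNIV (\<lambda>_. measure_pmf p)"
    by (simp add: gw_offspring_def restrict_UNIV)
  ultimately show ?thesis
    by (subst indep_vars_iff_distr_eq_PiM) simp_all
qed

lemma generation_cong:
  assumes "\<And>v. length v < n \<Longrightarrow> N v = N' v"
  shows "generation (gw_tree N) n = generation (gw_tree N') n"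
  using assms by (auto simp: generation_def gw_tree_def)

text \<open>Generation \<open>n\<close> is determined by the offspring numbers at depth below
  \<open>n\<close>, whereas the vertices of \<open>D\<close> have depth \<open>n\<close>: the two
  events concern disjoint sets of independent coordinates. If \<open>D\<close> contains a vertex of
  another depth, both sides vanish.\<close>

lemma prob_generation_offspring:
  assumes "finite D"
  shows "measure (gw_offspring p) {N. generation (gw_tree N) n = D \<and> (\<forall>v\<in>D. N v \<in> S)} =
    measure (gw_offspring p) {N. generation (gw_tree N) n = D} * measure (measure_pmf p) S ^ card D"
proof (cases "D \<subseteq> {v. length v = n}")
  case True
  interpret prob_space "gw_offspring p"
    by (rule prob_space_gw_offspring)
  let ?L = "{v :: vertex. length v < n}"
  let ?F = "PiM ?L (\<lambda>_. measure_pmf p)" and ?G = "PiM D (\<lambda>_. measure_pmf p)"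
  have ind: "indep_var ?F (\<lambda>N. restrict N ?L) ?G (\<lambda>N. restrict N D)"
    using True by (intro indep_var_restrict[OF indep_offspring]) auto
  define A where "A = {x \<in> space ?F. generation (gw_tree x) n = D}"
  define C where "C = {x \<in> space ?G. \<forall>v\<in>D. x v \<in> S}"
  have A: "A \<in> sets ?F"
  proof -
    have coord: "{x \<in> space ?F. v ! i < x (take i v)} \<in> sets ?F" if "length v = n" "i < n" for v i
    proof -
      have "(\<lambda>x. x (take i v)) \<in> measurable ?F (measure_pmf p)"
        using that by (intro measurable_component_singleton) auto
      from measurable_sets[OF this, of "{v ! i<..}"] show ?thesis
        by (simp add: vimage_def Int_def conj_commute)
    qed
    have "{x \<in> space ?F. \<forall>v. (length v = n \<and> (\<forall>i\<in>{..<n}. length v = n \<longrightarrow> v ! i < x (take i v))) \<longleftrightarrow> v \<in> D} \<in> sets ?F"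
      using coord
      by (intro sets.sets_Collect_countable_All sets.sets_Collect sets.sets_Collect_finite_All) auto
    also have "{x \<in> space ?F. \<forall>v. (length v = n \<and> (\<forall>i\<in>{..<n}. length v = n \<longrightarrow> v ! i < x (take i v))) \<longleftrightarrow> v \<in> D} = A"
      unfolding A_def generation_def gw_tree_def by (intro Collect_cong) auto
    finally show ?thesis .
  qed
  have C: "C \<in> sets ?G"
  proof -
    have "{x \<in> space ?G. x v \<in> S} \<in> sets ?G" if "v \<in> D" for v
    proof -
      have "(\<lambda>x. x v) \<in> measurable ?G (measure_pmf p)"
        using that by (intro measurable_component_singleton) auto
      from measurable_sets[OF this, of S] show ?thesis
        by (simp add: vimage_def Int_def conj_commute)
    qed
    then show ?thesis
      unfolding C_def using assms by (intro sets.sets_Collect_finite_All) auto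
  qed
  have gen: "generation (gw_tree (restrict N ?L)) n = generation (gw_tree N) n" for N
    by (rule generation_cong) simp
  have 1: "(\<lambda>N. restrict N ?L) -` A \<inter> space (gw_offspring p) = {N. generation (gw_tree N) n = D}"
    by (auto simp: A_def space_PiM gen)
  have 2: "(\<lambda>N. restrict N D) -` C \<inter> space (gw_offspring p) = {N. \<forall>v\<in>D. N v \<in> S}"
    by (auto simp: C_def space_PiM)
  have "(\<lambda>N. (restrict N ?L, restrict N D)) -` (A \<times> C) \<inter> space (gw_offspring p) =
      {N. generation (gw_tree N) n = D \<and> (\<forall>v\<in>D. N v \<in> S)}"
    using 1 2 by auto
  with indep_varD[OF ind A C] show ?thesis
    unfolding 1 2 using prob_finite_offspring[OF assms] by simp
next
  case False
  then have "generation (gw_tree N) n \<noteq> D" for N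
    by (auto simp: generation_def)
  then show ?thesis
    by simp
qed

lemma sets_card_generation: "{N. card (generation (gw_tree N) n) \<in> K} \<in> sets (gw_offspring p)"
proof -
  have "{N. card (generation (gw_tree N) n) \<in> K} =
      (\<Union>D\<in>{D. finite D \<and> card D \<in> K}. {N. generation (gw_tree N) n = D})"
    by (auto simp: finite_generation)
  moreover have "countable {D :: vertex set. finite D \<and> card D \<in> K}"
    by (rule countable_subset[OF _ countable_Collect_finite]) auto
  ultimately show ?thesis
    using sets_generation_eq by (simp add: sets.countable_UN'')
qed

text \<open>The event is split over the countably many sets \<open>D\<close> of \<open>k\<close>
  vertices. The factor from the offspring depends on \<open>D\<close> only through its size, so it
  comes out of the sum.\<close>

lemma prob_card_generation_offspring:
  "emeasure (gw_offspring p)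
     {N. card (generation (gw_tree N) n) = k \<and> (\<forall>v\<in>generation (gw_tree N) n. N v \<in> S)} =
   emeasure (gw_offspring p) {N. card (generation (gw_tree N) n) = k} *
     ennreal (measure (measure_pmf p) S ^ k)"
  and sets_card_generation_offspring:
  "{N. card (generation (gw_tree N) n) = k \<and> (\<forall>v\<in>generation (gw_tree N) n. N v \<in> S)}
     \<in> sets (gw_offspring p)"
proof -
  interpret prob_space "gw_offspring p"
    by (rule prob_space_gw_offspring)
  define K :: "vertex set set" where "K = {D. finite D \<and> card D = k}"
  have K: "countable K"
    unfolding K_def by (rule countable_subset[OF _ countable_Collect_finite]) auto
  define G H where "G D = {N. generation (gw_tree N) n = D}"
    and "H D = {N. generation (gw_tree N) n = D \<and> (\<forall>v\<in>D. N v \<in> S)}" for D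
  have G: "G D \<in> events" for D
    unfolding G_def by (rule sets_generation_eq)
  have H: "H D \<in> events" if "D \<in> K" for D
  proof -
    have "H D = G D \<inter> {N. \<forall>v\<in>D. N v \<in> S}"
      by (auto simp: G_def H_def)
    then show ?thesis
      using G sets_finite_offspring that by (auto simp: K_def)
  qed
  have UG: "{N. card (generation (gw_tree N) n) = k} = (\<Union>D\<in>K. G D)"
    by (auto simp: K_def G_def finite_generation)
  have UH: "{N. card (generation (gw_tree N) n) = k \<and> (\<forall>v\<in>generation (gw_tree N) n. N v \<in> S)} =
      (\<Union>D\<in>K. H D)"
    by (auto simp: K_def H_def finite_generation)
  have "emeasure (gw_offspring p) (\<Union>D\<in>K. H D) =
      (\<integral>\<^sup>+D. emeasure (gw_offspring p) (H D) \<partial>count_space K)"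
    using H K by (intro emeasure_UN_countable) (auto simp: disjoint_family_on_def H_def)
  also have "\<dots> = (\<integral>\<^sup>+D. emeasure (gw_offspring p) (G D) * ennreal (measure (measure_pmf p) S ^ k)
      \<partial>count_space K)"
    by (intro nn_integral_cong)
      (auto simp: emeasure_eq_measure G_def H_def K_def prob_generation_offspring ennreal_mult)
  also have "\<dots> = (\<integral>\<^sup>+D. emeasure (gw_offspring p) (G D) \<partial>count_space K) *
      ennreal (measure (measure_pmf p) S ^ k)"
    by (rule nn_integral_multc) simp
  also have "(\<integral>\<^sup>+D. emeasure (gw_offspring p) (G D) \<partial>count_space K) =
      emeasure (gw_offspring p) (\<Union>D\<in>K. G D)"
    using G K by (intro emeasure_UN_countable[symmetric]) (auto simp: disjoint_family_on_def G_def)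
  finally show "emeasure (gw_offspring p)
     {N. card (generation (gw_tree N) n) = k \<and> (\<forall>v\<in>generation (gw_tree N) n. N v \<in> S)} =
   emeasure (gw_offspring p) {N. card (generation (gw_tree N) n) = k} *
     ennreal (measure (measure_pmf p) S ^ k)"
    unfolding UG UH .
  show "{N. card (generation (gw_tree N) n) = k \<and> (\<forall>v\<in>generation (gw_tree N) n. N v \<in> S)}
     \<in> sets (gw_offspring p)"
    unfolding UH using H K by (intro sets.countable_UN'') auto
qed

text \<open>
  With \<open>Z\<^sub>n\<close> the size of generation \<open>n\<close>, the events \<open>Z\<^sub>n = k\<close> after which the size \<open>k\<close> is left for ever are disjoint in \<open>n\<close> and have
  probability at least a constant times that of \<open>Z\<^sub>n = k\<close>, so Borel--Cantelli applies.
\<close>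

lemma generation_size_transient:
  assumes S: "measure (measure_pmf p) S > 0"
    and leave: "AE N in gw_offspring p. \<forall>n. card (generation (gw_tree N) n) = k \<longrightarrow>
      (\<forall>v\<in>generation (gw_tree N) n. N v \<in> S) \<longrightarrow>
      (\<forall>m>n. card (generation (gw_tree N) m) \<noteq> k)"
  shows "AE N in gw_offspring p. eventually (\<lambda>n. card (generation (gw_tree N) n) \<noteq> k) sequentially"
proof -
  interpret prob_space "gw_offspring p"
    by (rule prob_space_gw_offspring)
  define c where "c = measure (measure_pmf p) S ^ k"
  have c: "c > 0"
    using S by (simp add: c_def)
  define G where "G n = {N. card (generation (gw_tree N) n) = k}" for n
  define H where "H n = {N. card (generation (gw_tree N) n) = k \<and>
    (\<forall>v\<in>generation (gw_tree N) n. N v \<in> S)}" for n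
  define B where "B n = G n - (\<Union>m\<in>{n<..}. G m)" for n
  have G: "G n \<in> events" for n
    using sets_card_generation[of n "{k}"] by (simp add: G_def)
  have H: "H n \<in> events" for n
    unfolding H_def by (rule sets_card_generation_offspring)
  have B: "B n \<in> events" for n
    unfolding B_def using G by auto
  have "prob (G n) * c \<le> prob (B n)" for n
  proof -
    have "ennreal (prob (H n)) = ennreal (prob (G n) * c)"
      unfolding emeasure_eq_measure[symmetric] using c
      by (simp add: H_def G_def prob_card_generation_offspring c_def ennreal_mult'' emeasure_eq_measure)
    then have "prob (G n) * c = prob (H n)"
      using c by simp
    also have "\<dots> \<le> prob (B n)"
    proof (rule finite_measure_mono_AE[OF _ B])
      show "AE N in gw_offspring p. N \<in> H n \<longrightarrow> N \<in> B n"
        using leave by eventually_elim (auto simp: H_def B_def G_def)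
    qed
    finally show ?thesis .
  qed
  then have le: "prob (G n) \<le> prob (B n) / c" for n
    using c by (simp add: pos_le_divide_eq)
  have "disjoint_family B"
    unfolding disjoint_family_on_def B_def by (fastforce elim: linorder_neqE_nat)
  then have "summable (\<lambda>n. prob (B n))"
    using B finite_measure_UNION[of B] by (auto intro: sums_summable)
  then have "summable (\<lambda>n. prob (B n) / c)"
    by (rule summable_divide)
  then have "summable (\<lambda>n. prob (G n))"
    by (rule summable_comparison_test') (simp add: le)
  then have "AE N in gw_offspring p. eventually (\<lambda>n. N \<in> space (gw_offspring p) - G n) sequentially"
    using G by (intro borel_cantelli_AE1) (auto simp: emeasure_eq_measure)
  then show ?thesis
    by (simp add: G_def)
qed

section \<open>Divergence of the generation sizes on survival\<close>

lemma AE_offspring_pos: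
  assumes "pmf p 0 = 0"
  shows "AE N in gw_offspring p. \<forall>v. N v > 0"
  unfolding AE_all_countable
proof
  fix v :: vertex
  have "AE i in measure_pmf p. i > 0"
    using assms by (auto simp: AE_measure_pmf_iff set_pmf_iff intro: gr0I)
  then show "AE N in gw_offspring p. N v > 0"
    unfolding gw_offspring_def by (intro AE_PiM_component) (auto intro: prob_space_measure_pmf)
qed

lemma card_generation_mono:
  assumes "\<forall>v. N v > 0" "n \<le> m"
  shows "card (generation (gw_tree N) n) \<le> card (generation (gw_tree N) m)"
  using assms(2)
proof (induction rule: dec_induct)
  case (step m)
  have "card (generation (gw_tree N) m) = (\<Sum>v\<in>generation (gw_tree N) m. 1)"
    by simp
  also have "\<dots> \<le> card (generation (gw_tree N) (Suc m))"
    unfolding card_generation_Suc using assms(1) by (intro sum_mono) (simp add: Suc_leI)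
  finally show ?case
    using step by simp
qed simp

lemma generation_extinct_mono:
  assumes "generation (gw_tree N) n = {}" "n \<le> m"
  shows "generation (gw_tree N) m = {}"
  using assms(2,1) by (induction rule: dec_induct) (auto simp: generation_Suc)

text \<open>There are two ways to leave size \<open>k\<close> for good with positive probability. If
  childless particles occur, all \<open>k\<close> of them may be childless, and the tree dies.
  Otherwise the sizes never decrease, and all \<open>k\<close> particles may have at least two
  children; this has positive probability because offspring numbers at most 1 would give a mean of
  at most 1.\<close>

lemma generation_size_eventually_ne:
  assumes mean: "mean_offspring p > 1" and k: "k > 0"
  shows "AE N in gw_offspring p. eventually (\<lambda>n. card (generation (gw_tree N) n) \<noteq> k) sequentially"
proof (cases "pmf p 0 = 0")
  case False
  show ?thesis
  proof (rule generation_size_transient[where S = "{0}"])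
    show "measure (measure_pmf p) {0} > 0"
      using False by (simp add: measure_pmf_single pmf_nonneg order.strict_iff_order)
    have "card (generation (gw_tree N) m) \<noteq> k"
      if "\<forall>v\<in>generation (gw_tree N) n. N v \<in> {0}" "m > n" for N n m
    proof -
      have "generation (gw_tree N) (Suc n) = {}"
        using that by (auto simp: generation_Suc)
      then have "generation (gw_tree N) m = {}"
        using that by (intro generation_extinct_mono[of N "Suc n" m]) auto
      then show ?thesis
        using k by simp
    qed
    then show "AE N in gw_offspring p. \<forall>n. card (generation (gw_tree N) n) = k \<longrightarrow>
        (\<forall>v\<in>generation (gw_tree N) n. N v \<in> {0}) \<longrightarrow>
        (\<forall>m>n. card (generation (gw_tree N) m) \<noteq> k)"
      by (intro AE_I2) blast
  qed
next
  case True
  show ?thesis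
  proof (rule generation_size_transient[where S = "{2..}"])
    show "measure (measure_pmf p) {2..} > 0"
    proof (rule ccontr)
      assume "\<not> measure (measure_pmf p) {2..} > 0"
      then have "measure (measure_pmf p) {2..} = 0"
        by (simp add: order.strict_iff_order)
      then have "set_pmf p \<inter> {2..} = {}"
        by (simp add: measure_pmf_zero_iff)
      then have "pmf p i = 0" if "i \<ge> 2" for i
        using that by (auto simp: set_pmf_iff)
      then have "real i * pmf p i = (if i = 1 then pmf p 1 else 0)" for i
        by (cases "i \<ge> 2") (auto simp: not_le less_2_cases_iff)
      then have "mean_offspring p = pmf p 1"
        unfolding mean_offspring_def by (simp add: sums_unique[OF sums_single, symmetric])
      then show False
        using mean pmf_le_1[of p 1] by simp
    qed
    have larger: "card (generation (gw_tree N) m) \<noteq> k"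
      if pos: "\<forall>v. N v > 0" and n: "card (generation (gw_tree N) n) = k"
        "\<forall>v\<in>generation (gw_tree N) n. N v \<in> {2..}" and "m > n" for N n m
    proof -
      have "2 * k = (\<Sum>v\<in>generation (gw_tree N) n. 2)"
        using n by simp
      also have "\<dots> \<le> card (generation (gw_tree N) (Suc n))"
        unfolding card_generation_Suc using n by (intro sum_mono) auto
      also have "\<dots> \<le> card (generation (gw_tree N) m)"
        using pos \<open>m > n\<close> by (intro card_generation_mono) auto
      finally show ?thesis
        using k by simp
    qed
    show "AE N in gw_offspring p. \<forall>n. card (generation (gw_tree N) n) = k \<longrightarrow>
        (\<forall>v\<in>generation (gw_tree N) n. N v \<in> {2..}) \<longrightarrow>
        (\<forall>m>n. card (generation (gw_tree N) m) \<noteq> k)"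
      using AE_offspring_pos[OF True] by eventually_elim (use larger in blast)
  qed
qed

text \<open>Survival excludes size 0, and each of the finitely many sizes strictly between 0 and
  \<open>Z\<close> is eventually avoided.\<close>

lemma generation_size_tendsto:
  assumes "mean_offspring p > 1"
  shows "AE N in gw_offspring p. \<not> extinct (gw_tree N) \<longrightarrow>
    filterlim (\<lambda>n. card (generation (gw_tree N) n)) at_top sequentially"
proof -
  have "AE N in gw_offspring p. \<forall>k. 0 < k \<longrightarrow>
      eventually (\<lambda>n. card (generation (gw_tree N) n) \<noteq> k) sequentially"
    unfolding AE_all_countable
  proof
    fix k :: nat
    show "AE N in gw_offspring p. 0 < k \<longrightarrow>
        eventually (\<lambda>n. card (generation (gw_tree N) n) \<noteq> k) sequentially"
      by (cases "0 < k") (simp_all add: generation_size_eventually_ne[OF assms])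
  qed
  then show ?thesis
  proof eventually_elim
    case (elim N)
    show ?case
    proof
      assume "\<not> extinct (gw_tree N)"
      then have ne: "card (generation (gw_tree N) n) \<noteq> 0" for n
        by (simp add: extinct_def finite_generation)
      show "filterlim (\<lambda>n. card (generation (gw_tree N) n)) at_top sequentially"
        unfolding filterlim_at_top
      proof
        fix Z
        have "eventually (\<lambda>n. \<forall>k\<in>{0<..<Z}. card (generation (gw_tree N) n) \<noteq> k) sequentially"
          using elim by (intro eventually_ball_finite) auto
        then show "eventually (\<lambda>n. Z \<le> card (generation (gw_tree N) n)) sequentially"
        proof eventually_elim
          case (elim n)
          show ?case
          proof (rule ccontr)
            assume "\<not> Z \<le> card (generation (gw_tree N) n)"
            then have "card (generation (gw_tree N) n) \<in> {0<..<Z}"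
              using ne[of n] by auto
            with elim show False
              by blast
          qed
        qed
      qed
    qed
  qed
qed

section \<open>Minimizing over paths with independent weights\<close>

text \<open>The full set of minimizers instead of a selected one: it can be compared for two inputs
  without regard to the breaking of ties.\<close>

definition minimizers :: "('v \<Rightarrow> 'i set) \<Rightarrow> 'v set \<Rightarrow> ('i \<Rightarrow> real) \<Rightarrow> 'v set" where
  "minimizers route D x = {v \<in> D. \<forall>u\<in>D. sum x (route v) \<le> sum x (route u)}"

text \<open>When the minimizer is unique, this is its route.\<close>

definition critical :: "('v \<Rightarrow> 'i set) \<Rightarrow> 'v set \<Rightarrow> ('i \<Rightarrow> real) \<Rightarrow> 'i set" where
  "critical route D x = (\<Union>v\<in>minimizers route D x. route v)"

lemma minimizers_nonempty:
  assumes "finite D" "D \<noteq> {}"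
  shows "minimizers route D x \<noteq> {}"
proof -
  have "arg_min_on (\<lambda>v. sum x (route v)) D \<in> minimizers route D x"
    using assms by (auto simp: minimizers_def arg_min_if_finite intro: arg_min_least)
  then show ?thesis
    by blast
qed

lemma minimizers_cong:
  assumes "\<And>v i. v \<in> D \<Longrightarrow> i \<in> route v \<Longrightarrow> x i = y i"
  shows "minimizers route D x = minimizers route D y"
proof -
  have "sum x (route v) = sum y (route v)" if "v \<in> D" for v
    using assms that by (intro sum.cong) auto
  then show ?thesis
    unfolding minimizers_def by auto
qed

lemma critical_cong:
  assumes "\<And>v i. v \<in> D \<Longrightarrow> i \<in> route v \<Longrightarrow> x i = y i"
  shows "critical route D x = critical route D y"
  using minimizers_cong[of D route x y] assms by (simp add: critical_def)

text \<open>Take a minimizer \<open>v\<close> for \<open>x\<close> and a minimizer \<open>w\<close>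
  for \<open>y\<close>. Neither route contains \<open>e\<close>, so both sums are the same under
  \<open>x\<close> and \<open>y\<close>. As \<open>v\<close> does at least as well as
  \<open>w\<close> under \<open>x\<close>, it does so under \<open>y\<close>, where \<open>w\<close>
  is optimal.\<close>

lemma minimizers_subset_change:
  assumes "finite D" "D \<noteq> {}"
    and agree: "\<And>v i. v \<in> D \<Longrightarrow> i \<in> route v \<Longrightarrow> i \<noteq> e \<Longrightarrow> x i = y i"
    and e: "e \<notin> critical route D x" "e \<notin> critical route D y"
  shows "minimizers route D x \<subseteq> minimizers route D y"
proof
  fix v
  assume v: "v \<in> minimizers route D x"
  obtain w where w: "w \<in> minimizers route D y"
    using minimizers_nonempty[OF assms(1,2)] by blast
  have D: "v \<in> D" "w \<in> D" and "e \<notin> route v" "e \<notin> route w"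
    using v w e by (auto simp: minimizers_def critical_def)
  then have "sum x (route v) = sum y (route v)" "sum x (route w) = sum y (route w)"
    using agree by (auto intro!: sum.cong)
  moreover have "sum x (route v) \<le> sum x (route w)"
    using v D by (simp add: minimizers_def)
  moreover have "\<forall>u\<in>D. sum y (route w) \<le> sum y (route u)"
    using w by (simp add: minimizers_def)
  ultimately show "v \<in> minimizers route D y"
    using D by (fastforce simp: minimizers_def)
qed

lemma minimizers_change:
  assumes "finite D" "D \<noteq> {}"
    and "\<And>v i. v \<in> D \<Longrightarrow> i \<in> route v \<Longrightarrow> i \<noteq> e \<Longrightarrow> x i = y i"
    and "e \<notin> critical route D x" "e \<notin> critical route D y"
  shows "minimizers route D x = minimizers route D y"
  using minimizers_subset_change[of D route e x y] minimizers_subset_change[of D route e y x] assms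
  by (metis subset_antisym)

lemma sum_indicator_subset:
  assumes "finite I" "A \<subseteq> I"
  shows "(\<Sum>i\<in>I. indicator A i) = real (card A)"
proof -
  have "(\<Sum>i\<in>I. indicator A i :: real) = (\<Sum>i\<in>A. indicator A i)"
    using assms by (intro sum.mono_neutral_right) (auto simp: indicator_def)
  then show ?thesis
    by simp
qed

lemma packing_number_singleton_le:
  assumes "T \<subseteq> {v}"
  shows "packing_number d \<epsilon> T \<le> 1"
  unfolding packing_number_def
proof (rule SUP_least)
  fix S
  assume "S \<in> {S. S \<subseteq> T \<and> finite S \<and> (\<forall>u\<in>S. \<forall>v\<in>S. u \<noteq> v \<longrightarrow> d u v > \<epsilon>)}"
  then have "card S \<le> card {v}"
    using assms by (intro card_mono) auto
  then show "enat (card S) \<le> 1"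
    by (simp add: one_enat_def)
qed

text \<open>What remains of the problem once the tree is fixed: routes of at most \<open>n\<close>
  indices, none contained in another. Each \<open>Y e\<close> is tied only to \<open>X\<close>;
  nothing is said about the joint law of different copies.\<close>

locale iid_path_minimization = prob_space M
  for M :: "'w measure" +
  fixes I :: "'i set" and P :: "real measure" and X :: "'i \<Rightarrow> 'w \<Rightarrow> real"
    and Y :: "'i \<Rightarrow> 'i \<Rightarrow> 'w \<Rightarrow> real"
    and route :: "'v \<Rightarrow> 'i set" and D :: "'v set" and n :: nat
  assumes finite_I: "finite I" and I_nonempty: "I \<noteq> {}"
    and finite_D: "finite D" and D_nonempty: "D \<noteq> {}"
    and route_subset: "v \<in> D \<Longrightarrow> route v \<subseteq> I"
    and card_route: "v \<in> D \<Longrightarrow> card (route v) \<le> n"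
    and route_diff: "u \<in> D \<Longrightarrow> v \<in> D \<Longrightarrow> u \<noteq> v \<Longrightarrow> route u - route v \<noteq> {}"
    and iid: "iid_family M I P X"
    and atomless: "emeasure P {a} = 0"
    and copy: "e \<in> I \<Longrightarrow> independent_copy M I X (Y e)"
begin

section \<open>Almost sure uniqueness of the minimizer\<close>

lemma indep_X: "indep_vars (\<lambda>_. borel) X I"
  and distr_X: "i \<in> I \<Longrightarrow> distr M borel (X i) = P"
  using iid by (auto simp: iid_family_def)

lemma measurable_X [measurable]: "i \<in> I \<Longrightarrow> X i \<in> borel_measurable M"
  using indep_X by (auto simp: indep_vars_def)

lemma sets_P: "sets P = sets borel"
  using distr_X I_nonempty by (metis all_not_in_conv sets_distr)

lemma prob_space_P: "prob_space P"
  using distr_X I_nonempty measurable_X by (metis all_not_in_conv prob_space_distr)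

lemma sets_PiM_P: "sets (PiM I (\<lambda>_. P)) = sets (PiM I (\<lambda>_. borel))"
  by (intro sets_PiM_cong) (simp_all add: sets_P)

lemma distr_restrict_X: "distr M (PiM I (\<lambda>_. borel)) (\<lambda>\<omega>. \<lambda>i\<in>I. X i \<omega>) = PiM I (\<lambda>_. P)"
proof -
  have "distr M (PiM I (\<lambda>_. borel)) (\<lambda>\<omega>. \<lambda>i\<in>I. X i \<omega>) = PiM I (\<lambda>i. distr M borel (X i))"
    using indep_vars_iff_distr_eq_PiM'[OF I_nonempty, of X "\<lambda>_. borel"] indep_X by simp
  also have "\<dots> = PiM I (\<lambda>_. P)"
    by (intro PiM_cong) (simp_all add: distr_X)
  finally show ?thesis .
qed

text \<open>Some weight \<open>X e\<close> occurs in the first sum only and is independent of all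
  the others. A tie forces it to equal a function of those others, which has probability zero by
  Fubini since \<open>P\<close> has no atoms.\<close>

lemma sum_route_ne:
  assumes "u \<in> D" "v \<in> D" "u \<noteq> v"
  shows "AE \<omega> in M. (\<Sum>i\<in>route u. X i \<omega>) \<noteq> (\<Sum>i\<in>route v. X i \<omega>)"
proof -
  obtain e where e: "e \<in> route u" "e \<notin> route v"
    using route_diff[OF assms] by blast
  have sub: "route u - {e} \<subseteq> I - {e}" "route v \<subseteq> I - {e}" and eI: "e \<in> I"
    using route_subset assms e by blast+
  \<comment> \<open>The value that \<open>X e\<close> must take for a tie.\<close>
  define W where "W = (\<lambda>x. (\<Sum>i\<in>route v. x i) - (\<Sum>i\<in>route u - {e}. x i) :: real)"
  have W_meas [measurable]: "W \<in> borel_measurable (PiM (I - {e}) (\<lambda>_. borel))"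
    unfolding W_def using sub
    by (intro borel_measurable_diff borel_measurable_sum measurable_component_singleton) auto
  define W' where "W' = W \<circ> (\<lambda>\<omega>. \<lambda>i\<in>I - {e}. X i \<omega>)"
  have "indep_var (PiM {e} (\<lambda>_. borel)) (\<lambda>\<omega>. \<lambda>i\<in>{e}. X i \<omega>)
      (PiM (I - {e}) (\<lambda>_. borel)) (\<lambda>\<omega>. \<lambda>i\<in>I - {e}. X i \<omega>)"
    using eI by (intro indep_var_restrict[OF indep_X]) auto
  from indep_var_compose[OF this, of "\<lambda>x. x e" borel W borel]
  have "indep_var borel (X e) borel W'"
    by (simp add: W'_def comp_def)
  then have rv: "X e \<in> borel_measurable M" "W' \<in> borel_measurable M"
    and law: "distr M borel (X e) \<Otimes>\<^sub>M distr M borel W' =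
      distr M (borel \<Otimes>\<^sub>M borel) (\<lambda>\<omega>. (X e \<omega>, W' \<omega>))"
    by (auto simp: indep_var_distribution_eq)
  interpret PX: prob_space "distr M borel (X e)"
    by (rule prob_space_distr) fact
  interpret PW: prob_space "distr M borel W'"
    by (rule prob_space_distr) fact
  interpret pair_prob_space "distr M borel (X e)" "distr M borel W'" ..
  let ?diag = "{z :: real \<times> real. fst z = snd z}"
  have "{z \<in> space (borel \<Otimes>\<^sub>M borel). fst z = (snd z :: real)} \<in> sets (borel \<Otimes>\<^sub>M borel)"
    by measurable
  then have diag: "?diag \<in> sets (borel \<Otimes>\<^sub>M borel)"
    by (simp add: space_pair_measure)
  \<comment> \<open>Each horizontal slice of the diagonal is a single point, hence null for
    \<open>P\<close>.\<close>
  have "emeasure (distr M borel (X e) \<Otimes>\<^sub>M distr M borel W') ?diag =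
      (\<integral>\<^sup>+w. emeasure P ((\<lambda>x. (x, w)) -` ?diag) \<partial>distr M borel W')"
    unfolding distr_X[OF eI, symmetric] using diag by (subst emeasure_pair_measure_alt2) auto
  also have "\<dots> = 0"
    by (simp add: vimage_def atomless)
  finally have "emeasure M ((\<lambda>\<omega>. (X e \<omega>, W' \<omega>)) -` ?diag \<inter> space M) = 0"
    using rv diag by (simp add: law emeasure_distr)
  then have "AE \<omega> in M. X e \<omega> \<noteq> W' \<omega>"
    using rv by (intro AE_I[where N = "(\<lambda>\<omega>. (X e \<omega>, W' \<omega>)) -` ?diag \<inter> space M"]) auto
  moreover have "(\<Sum>i\<in>route u. X i \<omega>) = X e \<omega> + (\<Sum>i\<in>route u - {e}. X i \<omega>)" for \<omega>
    using e route_subset[OF assms(1)] finite_I by (intro sum.remove) (auto intro: finite_subset)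
  moreover have "W' \<omega> = (\<Sum>i\<in>route v. X i \<omega>) - (\<Sum>i\<in>route u - {e}. X i \<omega>)" for \<omega>
    unfolding W'_def W_def comp_def using sub
    by (intro arg_cong2[where f = "(-)"] sum.cong) auto
  ultimately show ?thesis
    by auto
qed

lemma minimizers_unique: "AE \<omega> in M. \<exists>v\<in>D. minimizers route D (\<lambda>i. X i \<omega>) = {v}"
proof -
  have "AE \<omega> in M. \<forall>u\<in>D. \<forall>v\<in>D. u \<noteq> v \<longrightarrow> (\<Sum>i\<in>route u. X i \<omega>) \<noteq> (\<Sum>i\<in>route v. X i \<omega>)"
    using finite_D sum_route_ne by (intro AE_finite_allI) auto
  then show ?thesis
  proof (rule AE_mp, intro AE_I2 impI)
    fix \<omega>
    assume ne: "\<forall>u\<in>D. \<forall>v\<in>D. u \<noteq> v \<longrightarrow> (\<Sum>i\<in>route u. X i \<omega>) \<noteq> (\<Sum>i\<in>route v. X i \<omega>)"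
    obtain v where v: "v \<in> minimizers route D (\<lambda>i. X i \<omega>)"
      using minimizers_nonempty[OF finite_D D_nonempty] by blast
    have "w = v" if w: "w \<in> minimizers route D (\<lambda>i. X i \<omega>)" for w
    proof (rule ccontr)
      assume "w \<noteq> v"
      moreover have "w \<in> D" "v \<in> D"
        and "(\<Sum>i\<in>route w. X i \<omega>) = (\<Sum>i\<in>route v. X i \<omega>)"
        using v w by (auto simp: minimizers_def intro: antisym)
      ultimately show False
        using ne by blast
    qed
    with v have "minimizers route D (\<lambda>i. X i \<omega>) = {v}"
      by blast
    with v show "\<exists>v\<in>D. minimizers route D (\<lambda>i. X i \<omega>) = {v}"
      by (auto simp: minimizers_def)
  qed
qed

lemma critical_event_measurable:
  "{x \<in> space (PiM I (\<lambda>_. borel)). e \<in> critical route D x} \<in> sets (PiM I (\<lambda>_. borel))"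
proof -
  have "(\<lambda>x. sum x (route v) :: real) \<in> borel_measurable (PiM I (\<lambda>_. borel))" if "v \<in> D" for v
    by (rule borel_measurable_sum[where f = "\<lambda>i x. x i"], rule measurable_component_singleton)
      (use route_subset[OF that] in auto)
  then have "{x \<in> space (PiM I (\<lambda>_. borel :: real measure)).
      \<exists>v\<in>{v \<in> D. e \<in> route v}. \<forall>u\<in>D. sum x (route v) \<le> sum x (route u)} \<in> sets (PiM I (\<lambda>_. borel))"
    using finite_D
    by (intro sets.sets_Collect_finite_Ex sets.sets_Collect_finite_All borel_measurable_le) auto
  also have "{x \<in> space (PiM I (\<lambda>_. borel :: real measure)).
      \<exists>v\<in>{v \<in> D. e \<in> route v}. \<forall>u\<in>D. sum x (route v) \<le> sum x (route u)} =
      {x \<in> space (PiM I (\<lambda>_. borel)). e \<in> critical route D x}"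
    by (auto simp: critical_def minimizers_def)
  finally show ?thesis .
qed

section \<open>The law of the input after resampling one weight\<close>

definition perturbed_X :: "'i \<Rightarrow> 'w \<Rightarrow> 'i \<Rightarrow> real" where
  "perturbed_X e \<omega> = perturbed I {e} (\<lambda>i. X i \<omega>) (\<lambda>i. Y e i \<omega>)"

lemma measurable_restrict_Y:
  "e \<in> I \<Longrightarrow> (\<lambda>\<omega>. \<lambda>i\<in>I. Y e i \<omega>) \<in> measurable M (PiM I (\<lambda>_. borel))"
  using copy by (simp add: independent_copy_def indep_var_distribution_eq)

lemma measurable_Y [measurable]:
  assumes "e \<in> I" "i \<in> I"
  shows "Y e i \<in> borel_measurable M"
proof -
  have "(\<lambda>\<omega>. (\<lambda>i\<in>I. Y e i \<omega>) i) \<in> borel_measurable M"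
    using measurable_restrict_Y[OF assms(1)] assms(2)
    by (rule measurable_compose[OF _ measurable_component_singleton])
  with assms show ?thesis
    by simp
qed

lemma measurable_restrict_X: "(\<lambda>\<omega>. \<lambda>i\<in>I. X i \<omega>) \<in> measurable M (PiM I (\<lambda>_. borel))"
  by (intro measurable_restrict) auto

lemma measurable_perturbed_X:
  "e \<in> I \<Longrightarrow> perturbed_X e \<in> measurable M (PiM I (\<lambda>_. borel))"
  unfolding perturbed_X_def perturbed_def by (intro measurable_restrict) auto

text \<open>It is enough to test rectangles. There the event is the conjunction of one about
  \<open>X\<close> off \<open>e\<close> and one about \<open>Y e\<close> at \<open>e\<close>, and
  \<open>X\<close> and \<open>Y e\<close> are independent with the same product law.\<close>

lemma distr_perturbed_X:
  assumes e: "e \<in> I"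
  shows "distr M (PiM I (\<lambda>_. borel)) (perturbed_X e) = PiM I (\<lambda>_. P)"
proof -
  interpret Q: prob_space P
    by (rule prob_space_P)
  interpret Pi: finite_product_prob_space "\<lambda>_. P" I
    by standard (rule finite_I)
  let ?X = "\<lambda>\<omega>. \<lambda>i\<in>I. X i \<omega>" and ?Y = "\<lambda>\<omega>. \<lambda>i\<in>I. Y e i \<omega>" and ?B = "PiM I (\<lambda>_. borel :: real measure)"
  have indep: "indep_var ?B ?X ?B ?Y" and same: "distr M ?B ?Y = PiM I (\<lambda>_. P)"
    using copy[OF e] distr_restrict_X by (simp_all add: independent_copy_def)
  show ?thesis
  proof (rule Pi.PiM_eqI)
    show "finite I" "sets (distr M ?B (perturbed_X e)) = sets (PiM I (\<lambda>_. P))"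
      by (simp_all add: finite_I sets_PiM_P)
    fix A
    assume "\<And>i. i \<in> I \<Longrightarrow> A i \<in> sets P"
    then have A: "A i \<in> sets borel" if "i \<in> I" for i
      using that sets_P by simp
    \<comment> \<open>\<open>B\<close> leaves coordinate \<open>e\<close> free for \<open>X\<close>,
      and \<open>C\<close> leaves all other coordinates free for \<open>Y e\<close>.\<close>
    define B C where "B = A(e := UNIV)" and "C = (\<lambda>_. UNIV)(e := A e)"
    have BC: "B i \<in> sets borel" "C i \<in> sets borel" if "i \<in> I" for i
      using A that e by (auto simp: B_def C_def)
    have sets_BC: "Pi\<^sub>E I A \<in> sets ?B" "Pi\<^sub>E I B \<in> sets ?B" "Pi\<^sub>E I C \<in> sets ?B"
      using A BC finite_I by (auto intro!: sets_PiM_I_finite)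
    have P_UNIV: "measure P UNIV = 1"
      using Q.prob_space sets_eq_imp_space_eq[OF sets_P] by simp
    have prod: "measure (PiM I (\<lambda>_. P)) (Pi\<^sub>E I F) = (\<Prod>i\<in>I. measure P (F i))"
      if "\<And>i. i \<in> I \<Longrightarrow> F i \<in> sets borel" for F
      using that by (intro Pi.prob_times) (simp add: sets_P)
    have "perturbed_X e -` Pi\<^sub>E I A \<inter> space M = (\<lambda>\<omega>. (?X \<omega>, ?Y \<omega>)) -` (Pi\<^sub>E I B \<times> Pi\<^sub>E I C) \<inter> space M"
      using e by (auto simp: perturbed_X_def perturbed_def B_def C_def PiE_iff split: if_splits)
    then have "measure M (perturbed_X e -` Pi\<^sub>E I A \<inter> space M) =
        measure M (?X -` Pi\<^sub>E I B \<inter> space M) * measure M (?Y -` Pi\<^sub>E I C \<inter> space M)"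
      using indep_varD[OF indep sets_BC(2,3)] by simp
    also have "measure M (?X -` Pi\<^sub>E I B \<inter> space M) = measure (PiM I (\<lambda>_. P)) (Pi\<^sub>E I B)"
      unfolding distr_restrict_X[symmetric]
      by (rule measure_distr[symmetric, OF measurable_restrict_X sets_BC(2)])
    also have "measure M (?Y -` Pi\<^sub>E I C \<inter> space M) = measure (PiM I (\<lambda>_. P)) (Pi\<^sub>E I C)"
      unfolding same[symmetric]
      by (rule measure_distr[symmetric, OF measurable_restrict_Y[OF e] sets_BC(3)])
    also have "measure (PiM I (\<lambda>_. P)) (Pi\<^sub>E I B) = (\<Prod>i\<in>I - {e}. measure P (A i))"
      using BC e finite_I by (simp add: prod prod.remove[of I e] B_def P_UNIV)
    also have "measure (PiM I (\<lambda>_. P)) (Pi\<^sub>E I C) = measure P (A e)"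
      using BC e finite_I by (simp add: prod prod.remove[of I e] C_def P_UNIV)
    also have "(\<Prod>i\<in>I - {e}. measure P (A i)) * measure P (A e) = (\<Prod>i\<in>I. measure P (A i))"
      using e finite_I by (simp add: prod.remove[of I e])
    finally show "emeasure (distr M ?B (perturbed_X e)) (Pi\<^sub>E I A) = (\<Prod>i\<in>I. emeasure P (A i))"
      using measurable_perturbed_X[OF e] sets_BC(1)
      by (simp add: emeasure_distr emeasure_eq_measure Q.emeasure_eq_measure prod_ennreal)
  qed
qed

lemma prob_critical_perturbed:
  assumes e: "e \<in> I"
  shows "{\<omega> \<in> space M. e \<in> critical route D (\<lambda>i. X i \<omega>)} \<in> events"
    and "{\<omega> \<in> space M. e \<in> critical route D (perturbed_X e \<omega>)} \<in> events"
    and "prob {\<omega> \<in> space M. e \<in> critical route D (perturbed_X e \<omega>)} =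
      prob {\<omega> \<in> space M. e \<in> critical route D (\<lambda>i. X i \<omega>)}"
proof -
  let ?B = "PiM I (\<lambda>_. borel :: real measure)" and ?X = "\<lambda>\<omega>. \<lambda>i\<in>I. X i \<omega>"
  define S where "S = {x \<in> space ?B. e \<in> critical route D x}"
  have S: "S \<in> sets ?B"
    unfolding S_def by (rule critical_event_measurable)
  \<comment> \<open>Routes stay inside \<open>I\<close>, so restricting the input to
    \<open>I\<close>, which the product space requires, does not affect the critical
    indices.\<close>
  have "critical route D (?X \<omega>) = critical route D (\<lambda>i. X i \<omega>)" for \<omega>
    using route_subset by (intro critical_cong) auto
  then have 1: "{\<omega> \<in> space M. e \<in> critical route D (\<lambda>i. X i \<omega>)} = ?X -` S \<inter> space M"
    using measurable_space[OF measurable_restrict_X] by (auto simp: S_def)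
  have 2: "{\<omega> \<in> space M. e \<in> critical route D (perturbed_X e \<omega>)} = perturbed_X e -` S \<inter> space M"
    using measurable_space[OF measurable_perturbed_X[OF e]] by (auto simp: S_def)
  show "{\<omega> \<in> space M. e \<in> critical route D (\<lambda>i. X i \<omega>)} \<in> events"
    unfolding 1 by (rule measurable_sets[OF measurable_restrict_X S])
  show "{\<omega> \<in> space M. e \<in> critical route D (perturbed_X e \<omega>)} \<in> events"
    unfolding 2 by (rule measurable_sets[OF measurable_perturbed_X[OF e] S])
  show "prob {\<omega> \<in> space M. e \<in> critical route D (perturbed_X e \<omega>)} =
      prob {\<omega> \<in> space M. e \<in> critical route D (\<lambda>i. X i \<omega>)}"
    unfolding 1 2
    using measure_distr[OF measurable_restrict_X S] measure_distr[OF measurable_perturbed_X[OF e] S]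
    by (simp add: distr_restrict_X distr_perturbed_X[OF e])
qed

text \<open>The sum is the expected number of critical indices. Ties could push this number above
  \<open>n\<close>, but they have probability zero; otherwise the critical indices form a single
  route.\<close>

lemma sum_prob_critical_le:
  "(\<Sum>e\<in>I. prob {\<omega> \<in> space M. e \<in> critical route D (\<lambda>i. X i \<omega>)}) \<le> real n"
proof -
  define U where "U e = {\<omega> \<in> space M. e \<in> critical route D (\<lambda>i. X i \<omega>)}" for e
  have U: "e \<in> I \<Longrightarrow> U e \<in> events" for e
    unfolding U_def by (rule prob_critical_perturbed(1))
  have "(\<Sum>e\<in>I. prob (U e)) = expectation (\<lambda>\<omega>. \<Sum>e\<in>I. indicator (U e) \<omega>)"
    using U by (subst Bochner_Integration.integral_sum) (auto simp: emeasure_eq_measure)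
  also have "\<dots> \<le> expectation (\<lambda>\<omega>. real n)"
  proof (rule integral_mono_AE)
    show "AE \<omega> in M. (\<Sum>e\<in>I. indicator (U e) \<omega>) \<le> real n"
      using minimizers_unique
    proof (rule AE_mp, intro AE_I2 impI)
      fix \<omega>
      assume \<omega>: "\<omega> \<in> space M" and "\<exists>v\<in>D. minimizers route D (\<lambda>i. X i \<omega>) = {v}"
      then obtain v where v: "v \<in> D" "minimizers route D (\<lambda>i. X i \<omega>) = {v}"
        by blast
      have "(\<Sum>e\<in>I. indicator (U e) \<omega>) = (\<Sum>e\<in>I. indicator (route v) e :: real)"
        using v \<omega> by (intro sum.cong) (auto simp: U_def critical_def indicator_def)
      also have "\<dots> = real (card (route v))"
        using route_subset[OF v(1)] finite_I by (simp add: sum_indicator_subset)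
      finally show "(\<Sum>e\<in>I. indicator (U e) \<omega>) \<le> real n"
        using card_route[OF v(1)] by simp
    qed
  qed (use U in \<open>auto simp: emeasure_eq_measure\<close>)
  finally show ?thesis
    by (simp add: U_def prob_space)
qed

text \<open>Markov's inequality for the number of indices critical before the resampling plus the
  number critical after it. The conclusion provides an exceptional event \<open>B\<close> because
  \<open>vhat\<close> is an arbitrary selection depending on the set of minimizers, and the count of
  changes itself is not shown to be measurable.\<close>

lemma prob_many_changes:
  assumes "c > 0"
    and vhat: "\<And>x y. minimizers route D x = minimizers route D y \<Longrightarrow> vhat x = vhat y"
  shows "\<exists>B\<in>events. prob B \<le> 2 * real n / c \<and>
    (\<forall>\<omega>\<in>space M - B.
      real (card {e \<in> I. vhat (perturbed_X e \<omega>) \<noteq> vhat (\<lambda>i. X i \<omega>)}) < c)"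
proof -
  define U where "U e = {\<omega> \<in> space M. e \<in> critical route D (\<lambda>i. X i \<omega>)}" for e
  define U' where "U' e = {\<omega> \<in> space M. e \<in> critical route D (perturbed_X e \<omega>)}" for e
  have [measurable]: "U e \<in> events" "U' e \<in> events" if "e \<in> I" for e
    unfolding U_def U'_def using prob_critical_perturbed that by auto
  define F where "F \<omega> = (\<Sum>e\<in>I. indicator (U e) \<omega> + indicator (U' e) \<omega> :: real)" for \<omega>
  have F_int: "integrable M F"
    unfolding F_def by (intro Bochner_Integration.integrable_sum Bochner_Integration.integrable_add)
      (auto simp: emeasure_eq_measure)
  have F_nonneg: "0 \<le> F \<omega>" for \<omega>
    unfolding F_def by (intro sum_nonneg) auto
  have "expectation F = (\<Sum>e\<in>I. prob (U e) + prob (U' e))"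
    unfolding F_def
    by (subst Bochner_Integration.integral_sum) (auto simp: emeasure_eq_measure intro!: sum.cong)
  also have "\<dots> = 2 * (\<Sum>e\<in>I. prob (U e))"
    unfolding U_def U'_def using prob_critical_perturbed(3)
    by (simp add: sum_distrib_left)
  also have "\<dots> \<le> 2 * real n"
    unfolding U_def using sum_prob_critical_le by simp
  finally have EF: "expectation F \<le> 2 * real n" .
  have "{\<omega> \<in> space M. F \<omega> \<ge> c} \<in> events"
    using F_int by measurable
  moreover have "prob {\<omega> \<in> space M. F \<omega> \<ge> c} \<le> 2 * real n / c"
  proof -
    have "prob {\<omega> \<in> space M. F \<omega> \<ge> c} \<le> expectation F / c"
      using F_int F_nonneg \<open>c > 0\<close> by (intro integral_Markov_inequality_measure[where A = "{}"]) auto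
    also have "\<dots> \<le> 2 * real n / c"
      using EF \<open>c > 0\<close> by (simp add: divide_right_mono)
    finally show ?thesis .
  qed
  moreover have "real (card {e \<in> I. vhat (perturbed_X e \<omega>) \<noteq> vhat (\<lambda>i. X i \<omega>)}) < c"
    if \<omega>: "\<omega> \<in> space M - {\<omega> \<in> space M. F \<omega> \<ge> c}" for \<omega>
  proof -
    let ?bad = "{e \<in> I. vhat (perturbed_X e \<omega>) \<noteq> vhat (\<lambda>i. X i \<omega>)}"
    have "indicator ?bad e \<le> (indicator (U e) \<omega> + indicator (U' e) \<omega> :: real)" if "e \<in> I" for e
    proof (cases "\<omega> \<in> U e \<or> \<omega> \<in> U' e")
      case False
      have "minimizers route D (perturbed_X e \<omega>) = minimizers route D (\<lambda>i. X i \<omega>)"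
      proof (rule minimizers_change[OF finite_D D_nonempty, where e = e])
        show "perturbed_X e \<omega> i = X i \<omega>" if "v \<in> D" "i \<in> route v" "i \<noteq> e" for v i
          using that route_subset by (auto simp: perturbed_X_def perturbed_def)
      qed (use False \<omega> in \<open>auto simp: U_def U'_def\<close>)
      from vhat[OF this] show ?thesis
        by simp
    qed (auto simp: indicator_def)
    then have "(\<Sum>e\<in>I. indicator ?bad e) \<le> F \<omega>"
      unfolding F_def by (rule sum_mono)
    moreover have "(\<Sum>e\<in>I. indicator ?bad e) = real (card ?bad)"
      using finite_I by (simp add: sum_indicator_subset)
    ultimately show ?thesis
      using \<omega> by auto
  qed
  ultimately show ?thesis
    by blast
qed

text \<open>Outside the exceptional event of \<open>prob_many_changes\<close> with threshold
  \<open>\<epsilon> * real (card I)\<close>, one admissible subfamily has all its optimizers equal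
  to that of the unperturbed input, so the infimum is at most 1 and the level 2 is not
  reached.\<close>

lemma prob_packing_le:
  assumes "\<epsilon> > 0"
    and "\<And>x y. minimizers route D x = minimizers route D y \<Longrightarrow> vhat x = vhat y"
  shows "measure M {\<omega> \<in> space M.
      (INF A\<in>{A. A \<subseteq> I \<and> real (card A) > (1 - \<epsilon>) * real (card I)}.
         packing_number d \<epsilon>
           ((\<lambda>e. vhat (perturbed I {e} (\<lambda>i. X i \<omega>) (\<lambda>i. Y e i \<omega>))) ` A)) \<ge> enat 2}
    \<le> 2 / \<epsilon> * (real n / real (card I))" (is "measure M ?E \<le> _")
proof -
  have card_pos: "card I > 0"
    using finite_I I_nonempty by (simp add: card_gt_0_iff)
  then have pos: "\<epsilon> * real (card I) > 0"
    using \<open>\<epsilon> > 0\<close> by simp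
  obtain B where B: "B \<in> events" "prob B \<le> 2 * real n / (\<epsilon> * real (card I)) \<and>
      (\<forall>\<omega>\<in>space M - B.
        real (card {e \<in> I. vhat (perturbed_X e \<omega>) \<noteq> vhat (\<lambda>i. X i \<omega>)}) < \<epsilon> * real (card I))"
    using prob_many_changes[where vhat = vhat, OF pos assms(2)] by (rule bexE)
  have "?E \<subseteq> B"
  proof
    fix \<omega>
    assume \<omega>: "\<omega> \<in> ?E"
    show "\<omega> \<in> B"
    proof (rule ccontr)
      let ?bad = "{e \<in> I. vhat (perturbed_X e \<omega>) \<noteq> vhat (\<lambda>i. X i \<omega>)}"
      \<comment> \<open>The perturbations that leave the optimizer unchanged; fewer than a fraction
        \<epsilon> of the indices is lost.\<close>
      let ?A = "I - ?bad"
      assume "\<omega> \<notin> B"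
      with \<omega> have "real (card ?bad) < \<epsilon> * real (card I)"
        using B(2) by blast
      moreover have "real (card ?A) = real (card I) - real (card ?bad)"
        using finite_I card_mono[of I ?bad] by (subst card_Diff_subset) (auto simp: of_nat_diff)
      ultimately have A: "?A \<in> {A. A \<subseteq> I \<and> real (card A) > (1 - \<epsilon>) * real (card I)}"
        by (auto simp: algebra_simps)
      have "enat 2 \<le> (INF A\<in>{A. A \<subseteq> I \<and> real (card A) > (1 - \<epsilon>) * real (card I)}.
          packing_number d \<epsilon>
            ((\<lambda>e. vhat (perturbed I {e} (\<lambda>i. X i \<omega>) (\<lambda>i. Y e i \<omega>))) ` A))"
        using \<omega> by (simp only: mem_Collect_eq)
      also have "\<dots> \<le> packing_number d \<epsilon>
          ((\<lambda>e. vhat (perturbed I {e} (\<lambda>i. X i \<omega>) (\<lambda>i. Y e i \<omega>))) ` ?A)"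
        by (rule INF_lower[OF A])
      also have "\<dots> \<le> 1"
        by (rule packing_number_singleton_le[where v = "vhat (\<lambda>i. X i \<omega>)"])
          (auto simp: perturbed_X_def)
      finally have "enat 2 \<le> 1" .
      then show False
        by (simp add: one_enat_def)
    qed
  qed
  \<comment> \<open>Monotonicity asks for measurability of the larger set only.\<close>
  then have "prob ?E \<le> prob B"
    using B(1) by (rule finite_measure_mono)
  with B(2) show ?thesis
    by simp
qed

end

section \<open>Stability\<close>

text \<open>\<open>arg_min_on\<close> applies the choice operator to the predicate of being a
  minimizer, so equal sets of minimizers yield the same choice, ties included.\<close>

lemma leftmost_cong:
  assumes "minimizers path_edges (generation (gw_tree N) n) x =
    minimizers path_edges (generation (gw_tree N) n) y"
  shows "leftmost (gw_tree N) n x = leftmost (gw_tree N) n y"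
proof -
  have "is_arg_min (position (gw_tree N) x) (\<lambda>v. v \<in> generation (gw_tree N) n) v \<longleftrightarrow>
      v \<in> minimizers path_edges (generation (gw_tree N) n) x" for x v
    by (auto simp: is_arg_min_linorder minimizers_def position_def generation_def
        geodesic_edges_from_root)
  with assms show ?thesis
    by (simp add: leftmost_def arg_min_on_def arg_min_def)
qed

lemma stable_leftmost:
  assumes M: "prob_space M" and iid: "iid_family M (edges (gw_tree N)) P X"
    and atomless: "\<And>a. emeasure P {a} = 0"
    and copy: "\<And>n e. e \<in> edges_upto (gw_tree N) n \<Longrightarrow>
      independent_copy M (edges_upto (gw_tree N) n) X (Y n e)"
    and survival: "\<not> extinct (gw_tree N)"
    and growth: "(\<lambda>n. real n / real (card (edges_upto (gw_tree N) n))) \<longlonglongrightarrow> 0"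
  shows "stable_under_small_perturbations M
    (edges_upto (gw_tree N)) (\<lambda>n. X) (edges_upto (gw_tree N)) (\<lambda>n e. {e}) Y
    (leftmost (gw_tree N)) d"
  unfolding stable_under_small_perturbations_def
proof (intro conjI allI impI)
  fix n
  show "finite (edges_upto (gw_tree N) n)"
    by (rule finite_edges_upto)
  show "(\<Union>l\<in>edges_upto (gw_tree N) n. {l}) = edges_upto (gw_tree N) n"
    by simp
next
  fix \<epsilon> \<delta> :: real
  assume \<epsilon>: "\<epsilon> > 0" and \<delta>: "\<delta> > 0"
  interpret prob_space M
    by fact
  \<comment> \<open>The level 2 serves as the bound \<open>K\<close> for all \<epsilon> and \<delta>
    at once.\<close>
  define E where "E n = {\<omega> \<in> space M.
      (INF A\<in>{A. A \<subseteq> edges_upto (gw_tree N) n \<and>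
          real (card A) > (1 - \<epsilon>) * real (card (edges_upto (gw_tree N) n))}.
         packing_number (d n) \<epsilon> ((\<lambda>e. leftmost (gw_tree N) n
           (perturbed (edges_upto (gw_tree N) n) {e} (\<lambda>i. X i \<omega>) (\<lambda>i. Y n e i \<omega>))) ` A))
      \<ge> enat 2}" for n
  \<comment> \<open>For \<open>n = 0\<close> there are no edges and the locale does not apply; the
    limit superior ignores this index.\<close>
  have le: "measure M (E n) \<le> 2 / \<epsilon> * (real n / real (card (edges_upto (gw_tree N) n)))"
    if "n > 0" for n
  proof -
    have gen: "generation (gw_tree N) n \<noteq> {}"
      using survival by (auto simp: extinct_def)
    then obtain u where u: "u \<in> generation (gw_tree N) n"
      by blast
    with \<open>n > 0\<close> have "parent_edge u \<in> edges_upto (gw_tree N) n"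
      using path_edges_subset[OF u] parent_edge_in_path_edges[of u] by (auto simp: generation_def)
    then have ne: "edges_upto (gw_tree N) n \<noteq> {}"
      by blast
    have "edges_upto (gw_tree N) n \<subseteq> edges (gw_tree N)"
      by (auto simp: edges_upto_def)
    then have "iid_family M (edges_upto (gw_tree N) n) P X"
      using iid indep_vars_subset by (auto simp: iid_family_def)
    then interpret iid_path_minimization M "edges_upto (gw_tree N) n" P X "Y n" path_edges
        "generation (gw_tree N) n" n
    proof unfold_locales
      fix u v
      assume uv: "u \<in> generation (gw_tree N) n" "v \<in> generation (gw_tree N) n" "u \<noteq> v"
      then have "u \<noteq> []"
        by (auto simp: generation_def)
      then show "path_edges u - path_edges v \<noteq> {}"
        using parent_edge_in_path_edges[of u] parent_edge_notin_path_edges[of u v] uv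
        by (auto simp: generation_def)
    next
      fix v
      assume "v \<in> generation (gw_tree N) n"
      then show "card (path_edges v) \<le> n"
        using card_path_edges_le[of v] by (simp add: generation_def)
    qed (use gen ne atomless copy finite_generation finite_edges_upto path_edges_subset in auto)
    show ?thesis
      unfolding E_def by (rule prob_packing_le[OF \<epsilon> leftmost_cong])
  qed
  have "(\<lambda>n. 2 / \<epsilon> * (real n / real (card (edges_upto (gw_tree N) n)))) \<longlonglongrightarrow> 2 / \<epsilon> * 0"
    by (intro tendsto_mult_left growth)
  then have lim: "(\<lambda>n. 2 / \<epsilon> * (real n / real (card (edges_upto (gw_tree N) n)))) \<longlonglongrightarrow> 0"
    by simp
  have "(\<lambda>n. measure M (E n)) \<longlonglongrightarrow> 0"
  proof (rule tendsto_sandwich[OF _ _ tendsto_const lim])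
    show "eventually (\<lambda>n. 0 \<le> measure M (E n)) sequentially"
      by simp
    show "eventually (\<lambda>n. measure M (E n) \<le>
        2 / \<epsilon> * (real n / real (card (edges_upto (gw_tree N) n)))) sequentially"
      using eventually_gt_at_top[of 0] by eventually_elim (rule le)
  qed
  then have "(\<lambda>n. ereal (measure M (E n))) \<longlonglongrightarrow> ereal 0"
    by simp
  then have "limsup (\<lambda>n. ereal (measure M (E n))) = ereal 0"
    by (intro lim_imp_Limsup) simp_all
  then have "limsup (\<lambda>n. ereal (measure M (E n))) \<le> ereal \<delta>"
    using \<delta> by simp
  then show "\<exists>K. limsup (\<lambda>n. ereal (measure M {\<omega> \<in> space M.
      (INF A\<in>{A. A \<subseteq> edges_upto (gw_tree N) n \<and>
          real (card A) > (1 - \<epsilon>) * real (card (edges_upto (gw_tree N) n))}.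
         packing_number (d n) \<epsilon> ((\<lambda>e. leftmost (gw_tree N) n
           (perturbed (edges_upto (gw_tree N) n) {e} (\<lambda>i. X i \<omega>) (\<lambda>i. Y n e i \<omega>))) ` A))
      \<ge> enat K})) \<le> ereal \<delta>"
    unfolding E_def by (rule exI)
qed

theorem theorem3p1p7:
  fixes p :: "nat pmf" and P :: "real measure" and f \<rho> g :: "real \<Rightarrow> real"
  assumes "supercritical_kesten_stigum p"
    and "prob_space P" and "integrable P (\<lambda>x. x)"
    and "f \<in> borel_measurable borel" and "\<And>x. f x \<ge> 0"
    and "P = density lborel (\<lambda>x. ennreal (f x))"
    and "langevin P \<rho> g"
    and "strict_mono g \<or> monotone (<) (>) g"
    and "\<exists>t>0. Psi p P t \<in> range ereal"
  shows "AE N in gw_offspring p. \<not> extinct (gw_tree N) \<longrightarrow>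
    (\<forall>(M :: 'w measure) (X :: edge \<Rightarrow> 'w \<Rightarrow> real) (Y :: nat \<Rightarrow> edge \<Rightarrow> edge \<Rightarrow> 'w \<Rightarrow> real).
       prob_space M \<and> iid_family M (edges (gw_tree N)) P X \<and>
       (\<forall>n. \<forall>e\<in>edges_upto (gw_tree N) n. independent_copy M (edges_upto (gw_tree N) n) X (Y n e))
       \<longrightarrow>
       stable_under_small_perturbations M
         (edges_upto (gw_tree N)) (\<lambda>n. X)
         (edges_upto (gw_tree N)) (\<lambda>n e. {e}) Y
         (leftmost (gw_tree N)) (gen_dist (gw_tree N)))"
proof -
  \<comment> \<open>The density makes \<open>P\<close> absolutely continuous, and points are
    Lebesgue null.\<close>
  have atomless: "emeasure P {a} = 0" for a
  proof -
    have "emeasure P {a} = (\<integral>\<^sup>+x. ennreal (f x) * indicator {a} x \<partial>lborel)"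
      using assms(4,6) by (simp add: emeasure_density)
    also have "\<dots> = (\<integral>\<^sup>+(x::real). 0 \<partial>lborel)"
      using AE_lborel_singleton[of a] by (intro nn_integral_cong_AE) (auto elim: eventually_mono)
    finally show ?thesis
      by simp
  qed
  have "mean_offspring p > 1"
    using assms(1) by (simp add: supercritical_kesten_stigum_def)
  then have "AE N in gw_offspring p. \<not> extinct (gw_tree N) \<longrightarrow>
      filterlim (\<lambda>n. card (generation (gw_tree N) n)) at_top sequentially"
    by (rule generation_size_tendsto)
  then show ?thesis
  proof eventually_elim
    \<comment> \<open>The exceptional null set of trees depends on the offspring law alone, so it is
      fixed before \<open>M\<close>, \<open>X\<close> and \<open>Y\<close> are chosen.\<close>
    case (elim N)
    show ?case
    proof (intro impI allI)
      fix M :: "'w measure" and X :: "edge \<Rightarrow> 'w \<Rightarrow> real" and Y :: "nat \<Rightarrow> edge \<Rightarrow> edge \<Rightarrow> 'w \<Rightarrow> real"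
      assume survival: "\<not> extinct (gw_tree N)"
        and MXY: "prob_space M \<and> iid_family M (edges (gw_tree N)) P X \<and>
          (\<forall>n. \<forall>e\<in>edges_upto (gw_tree N) n. independent_copy M (edges_upto (gw_tree N) n) X (Y n e))"
      then have "(\<lambda>n. real n / real (card (edges_upto (gw_tree N) n))) \<longlonglongrightarrow> 0"
        using elim by (intro edges_upto_superlinear) simp
      with survival MXY show "stable_under_small_perturbations M
          (edges_upto (gw_tree N)) (\<lambda>n. X) (edges_upto (gw_tree N)) (\<lambda>n e. {e}) Y
          (leftmost (gw_tree N)) (gen_dist (gw_tree N))"
        using atomless by (intro stable_leftmost) auto
    qed
  qed
qed

end
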